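(* Let $d\ge 2$, consider a brickwork circuit all of whose gates $U_{x,y}$ on $\mathbb C^d\otimes\mathbb C^d$ are dual-unitary (the gates may depend on the space-time point $(x,y)$), and let $m$ be a $d\times d$ complex matrix with $\operatorname{tr}[mm^\dagger]=d$. Let $\gamma=(\gamma_1,\dots,\gamma_{2t})\in\{+1,-1\}^{2t}$ be any time-like path, with left influence matrix $L_\gamma\in(\mathbb C^d\otimes\mathbb C^d)^{\otimes 2t}$. Let $A$ be the set of the first (top) $|A|$ legs of $L_\gamma$ and $\bar A$ the set of the remaining $2t-|A|$ legs. Let $\tau_A$ (resp. $\tau_{\bar A}$) be the number of indices $i$ in $A$ (resp. $\bar A$) with $\gamma_i=+1$, and let $\tau=\tau_A+\tau_{\bar A}$ (so $\tau=(1+v_\gamma)t$ with $v_\gamma=\frac1{2t}\sum_i\gamma_i$). Then for every real $\alpha>1$ $$S^{(\alpha)}_A(\gamma)\ \le\ \frac{\alpha}{\alpha-1}\,\log\!\left[\frac{d^{\tau_A}\,\mathcal P(\tau/2)}{\mathcal P(\tau_{\bar A}/2)}\right],$$ where $S_A^{(\alpha)}(\gamma)$ is the $\alpha$-R\'enyi entropy of the normalised vector $L_\gamma$ across the bipartition $A\bar A$, and $\mathcal P(n/2)$ ($n=0,1,2,\dots$) is the purity of a half-line of the time-evolved state at time $n/2$.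
   Context: Gates. A gate is a unitary matrix $U$ on $\mathbb C^d\otimes\mathbb C^d$ with entries $U_{(k,l);(i,j)}$, where $i,j$ are the bottom-left and bottom-right (input) indices and $k,l$ the top-left and top-right (output) indices. $U$ is dual-unitary if in addition the matrix $\tilde U$ with $\tilde U_{(k,i),(l,j)}:=U_{(k,l);(i,j)}$ is unitary. Brickwork geometry. Qudits ($\mathbb C^d$) sit at half-odd-integer positions. Row $0$: for each even integer $x$, the sites $x-\frac12,x+\frac12$ are prepared in the pair state $d^{-1/2}\sum_{i,j}m_{ij}|i\rangle|j\rangle$. Row $y\ge1$: a gate $U_{x,y}$ is applied to the sites $x-\frac12,x+\frac12$ for every integer $x\equiv y \pmod 2$; this is the gate at $(x,y)$. One unit of time consists of two rows. Folded tensors. Every bond carries the doubled space $\mathbb C^d\otimes\mathbb C^d$. The folded gate at $(x,y)$ is $U_{x,y}\otimes U_{x,y}^*$ (complex conjugate on the second copy, corresponding legs grouped), with four legs: bottom-left, bottom-right, top-left, top-right. The folded initial tensor is $m\otimes m^*$ (not normalised by $d$), with two legs, top-left and top-right. The loop state is $d^{-1/2}\sum_{i}|i\rangle\otimes|i\rangle\in\mathbb C^d\otimes\mathbb C^d$. The top-right leg of the tensor at $(x,y)$ is contracted with the bottom-left leg of the gate at $(x+1,y+1)$, and the top-left leg with the bottom-right leg of the gate at $(x-1,y+1)$. Influence matrix. Given $\gamma\in\{\pm1\}^{N}$, fix an even integer $b$ (the bottom end point), set $x_N=b$ and $x_{i-1}=x_i-\gamma_i$, and consider the path visiting $(x_i,N-i)$,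 $i=0,\dots,N$, from row $N$ at the top down to row $0$. Keep all folded tensors at positions $(x,y)$, $0\le y\le N$, with $x\le x_{N-y}$ (folded gates for $y\ge1$, folded initial tensors for $y=0$), truncated by an open boundary sufficiently far to the left (the result does not depend on where). All top legs at the top of row $N$ (including those of any idle site at the left boundary) are contracted with the loop state. The remaining open legs are exactly $N$, one for each step: if $\gamma_i=+1$ it is the top-right leg of the tensor at $(x_i,N-i)$; if $\gamma_i=-1$ it is the bottom-right leg of the gate at $(x_{i-1},N-i+1)$. The resulting (unnormalised) vector $L_\gamma\in(\mathbb C^d\otimes\mathbb C^d)^{\otimes N}$, with legs ordered $i=1,\dots,N$ from top to bottom, is the left influence matrix. Here $N=2t$. Purity. $\mathcal P(n/2)=\operatorname{tr}[\rho^2]$, where $\rho$ is the reduced density matrix, on all sites to the right of the integer position $b-n+1$, of the normalised state obtained from the pair state by applying rows $1,\dots,n$, on a finite open chain extending sufficiently far on both sides of the cut (the value does not depend on the chain length once it is large enough; if the gate is the same everywhere it does not depend on $b$ either). In particular $\mathcal P(0)=1$. Entropy. $\rho_{\gamma,A}=\operatorname{tr}_{\bar A}\big(|L_\gamma\rangle\langle L_\gamma|\big)/\|L_\gamma\|^2$ and $S_A^{(\alpha)}(\gamma)=\frac1{1-\alpha}\log\operatorname{tr}[\rho_{\gamma,A}^\alpha]$. *)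

theory Defs
  imports
    Complex_Main
    "HOL-Library.FuncSet"
    "HOL-Library.Countable_Set"
    "HOL-Library.Cardinality"
    "Jordan_Normal_Form.Char_Poly"
begin

section \<open>Gates\<close>

text \<open>
  The local Hilbert space \<open>\<complex>\<^sup>d\<close> has the basis given by the elements of a finite type, so \<open>d\<close> is
  the cardinality of that type. A gate is given by its matrix entries:
  \<open>U (k, l) (i, j)\<close> has the output (top) indices \<open>k, l\<close> and the input (bottom) indices \<open>i, j\<close>.
\<close>

type_synonym 'q gate = "'q \<times> 'q \<Rightarrow> 'q \<times> 'q \<Rightarrow> complex"

definition unitary :: "('i::finite \<Rightarrow> 'i \<Rightarrow> complex) \<Rightarrow> bool" where
  "unitary V \<longleftrightarrow>
     (\<forall>p q. (\<Sum>r\<in>UNIV. V p r * cnj (V q r)) = of_bool (p = q)) \<and>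
     (\<forall>p q. (\<Sum>r\<in>UNIV. cnj (V r p) * V r q) = of_bool (p = q))"

definition dual_gate :: "'q gate \<Rightarrow> 'q gate" where
  "dual_gate U = (\<lambda>(k, i) (l, j). U (k, l) (i, j))"

definition dual_unitary :: "('d::finite) gate \<Rightarrow> bool" where
  "dual_unitary U \<longleftrightarrow> unitary U \<and> unitary (dual_gate U)"


section \<open>Brickwork geometry\<close>

text \<open>
  The site at the half-odd-integer position \<open>k + 1/2\<close> is labelled by the integer \<open>k\<close>. The gate (or
  the pair state, for \<open>y = 0\<close>) at \<open>(x, y)\<close> then acts on the sites \<open>x - 1\<close> and \<open>x\<close>. Row \<open>y\<close> on the
  sites \<open>{a - 1..r}\<close>, with \<open>a\<close> even the position of the leftmost pair state, consists of all gates both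
  of whose sites lie in that range; a boundary site not met by any of them is idle.
\<close>

definition gate_positions :: "int \<Rightarrow> int \<Rightarrow> nat \<Rightarrow> int set" where
  "gate_positions a r y = {x. a \<le> x \<and> x \<le> r \<and> even (x - int y)}"

definition idle_sites :: "int \<Rightarrow> int \<Rightarrow> nat \<Rightarrow> int set" where
  "idle_sites a r y = {a - 1..r} - (\<Union>x\<in>gate_positions a r y. {x - 1, x})"

text \<open>Product of the tensors of row \<open>y\<close>, with top labels \<open>\<sigma>\<close> and bottom labels \<open>\<sigma>'\<close>.\<close>

definition row_tensor ::
  "(int \<Rightarrow> nat \<Rightarrow> 'q gate) \<Rightarrow> int \<Rightarrow> int \<Rightarrow> nat \<Rightarrow> (int \<Rightarrow> 'q) \<Rightarrow> (int \<Rightarrow> 'q) \<Rightarrow> complex" where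
  "row_tensor G a r y \<sigma> \<sigma>' =
     (\<Prod>x\<in>gate_positions a r y. G x y (\<sigma> (x - 1), \<sigma> x) (\<sigma>' (x - 1), \<sigma>' x)) *
     (\<Prod>k\<in>idle_sites a r y. of_bool (\<sigma> k = \<sigma>' k))"

definition pair_tensor ::
  "('q \<Rightarrow> 'q \<Rightarrow> complex) \<Rightarrow> int \<Rightarrow> int \<Rightarrow> (int \<Rightarrow> 'q) \<Rightarrow> complex" where
  "pair_tensor M a r \<sigma> = (\<Prod>x\<in>gate_positions a r 0. M (\<sigma> (x - 1)) (\<sigma> x))"


section \<open>Time-evolved state and half-line purity\<close>

text \<open>Amplitudes, after rows \<open>1, \<dots>, n\<close>, of the state on the open chain with sites \<open>{a - 1..c}\<close>.\<close>

fun evolved_state ::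
  "(int \<Rightarrow> nat \<Rightarrow> ('d::finite) gate) \<Rightarrow> ('d \<Rightarrow> 'd \<Rightarrow> complex) \<Rightarrow> int \<Rightarrow> int \<Rightarrow> nat \<Rightarrow>
     (int \<Rightarrow> 'd) \<Rightarrow> complex" where
  "evolved_state U m a c 0 \<sigma> =
     pair_tensor (\<lambda>i j. m i j / of_real (sqrt (real CARD('d)))) a c \<sigma>"
| "evolved_state U m a c (Suc n) \<sigma> =
     (\<Sum>\<sigma>'\<in>{a - 1..c} \<rightarrow>\<^sub>E UNIV. row_tensor U a c (Suc n) \<sigma> \<sigma>' * evolved_state U m a c n \<sigma>')"

text \<open>
  Reduced density matrix on the sites to the right of the integer position \<open>s\<close>, that is, on the
  sites labelled \<open>{s..c}\<close>; its rows and columns are indexed by \<open>{s..c} \<rightarrow>\<^sub>E UNIV\<close>.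
\<close>

definition half_line_density ::
  "(int \<Rightarrow> nat \<Rightarrow> ('d::finite) gate) \<Rightarrow> ('d \<Rightarrow> 'd \<Rightarrow> complex) \<Rightarrow> int \<Rightarrow> int \<Rightarrow> nat \<Rightarrow> int \<Rightarrow>
     (int \<Rightarrow> 'd) \<Rightarrow> (int \<Rightarrow> 'd) \<Rightarrow> complex" where
  "half_line_density U m a c n s \<rho> \<rho>' =
     (\<Sum>\<tau>\<in>{a - 1..<s} \<rightarrow>\<^sub>E UNIV.
        evolved_state U m a c n (\<lambda>k. if k < s then \<tau> k else \<rho> k) *
        cnj (evolved_state U m a c n (\<lambda>k. if k < s then \<tau> k else \<rho>' k)))"

text \<open>The purity \<open>\<P>(n/2)\<close>, computed on the open chain with sites \<open>{a - 1..c}\<close>.\<close>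

definition purity ::
  "(int \<Rightarrow> nat \<Rightarrow> ('d::finite) gate) \<Rightarrow> ('d \<Rightarrow> 'd \<Rightarrow> complex) \<Rightarrow> int \<Rightarrow> int \<Rightarrow> int \<Rightarrow> nat \<Rightarrow> real" where
  "purity U m a c b n =
     (let s = b - int n + 1; R = {s..c} \<rightarrow>\<^sub>E UNIV; \<rho> = half_line_density U m a c n s
      in Re (\<Sum>\<sigma>\<in>R. \<Sum>\<sigma>'\<in>R. \<rho> \<sigma> \<sigma>' * \<rho> \<sigma>' \<sigma>))"


section \<open>Left influence matrix\<close>

definition fold_gate :: "'d gate \<Rightarrow> ('d \<times> 'd) gate" where
  "fold_gate U = (\<lambda>((k, k'), (l, l')) ((i, i'), (j, j')).
     U (k, l) (i, j) * cnj (U (k', l') (i', j')))"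

definition fold_pair :: "('d \<Rightarrow> 'd \<Rightarrow> complex) \<Rightarrow> 'd \<times> 'd \<Rightarrow> 'd \<times> 'd \<Rightarrow> complex" where
  "fold_pair m = (\<lambda>(i, i') (j, j'). m i j * cnj (m i' j'))"

definition loop_state :: "('d::finite) \<times> 'd \<Rightarrow> complex" where
  "loop_state = (\<lambda>(i, i'). of_bool (i = i') / of_real (sqrt (real CARD('d))))"

text \<open>
  A path \<open>\<gamma>\<^sub>1, \<dots>, \<gamma>\<^sub>N\<close> is a list, so that \<open>\<gamma>\<^sub>i\<close> is \<open>\<gamma> ! (i - 1)\<close>. The position \<open>x\<^sub>i\<close> below is the
  solution of \<open>x\<^sub>N = b\<close>, \<open>x\<^bsub>i-1\<^esub> = x\<^sub>i - \<gamma>\<^sub>i\<close>.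
\<close>

definition path_pos :: "int list \<Rightarrow> int \<Rightarrow> nat \<Rightarrow> int" where
  "path_pos \<gamma> b i = b - sum_list (drop i \<gamma>)"

text \<open>
  Bond \<open>(k, y)\<close> is the segment of the world line of site \<open>k\<close> between rows \<open>y\<close> and \<open>y + 1\<close> (above
  row \<open>N\<close> if \<open>y = N\<close>). The open leg \<open>i\<close> is a bond at \<open>y = N - i\<close>: the top-right leg of the tensor at
  \<open>(x\<^sub>i, N - i)\<close> is the bond of site \<open>x\<^sub>i\<close>, and the bottom-right leg of the gate at
  \<open>(x\<^bsub>i-1\<^esub>, N - i + 1)\<close> is the bond of site \<open>x\<^bsub>i-1\<^esub>\<close>.
\<close>

definition open_leg_site :: "int list \<Rightarrow> int \<Rightarrow> nat \<Rightarrow> int" where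
  "open_leg_site \<gamma> b i =
     (if \<gamma> ! (i - 1) = 1 then path_pos \<gamma> b i else path_pos \<gamma> b (i - 1))"

text \<open>
  All bonds between rows \<open>y\<close> and \<open>y + 1\<close> which are attached to a tensor that is kept. For \<open>y < N\<close>
  the last one is the open leg \<open>N - y\<close>; for \<open>y = N\<close> both arguments of the maximum are \<open>x\<^sub>0\<close>.
\<close>

definition bond_sites :: "int list \<Rightarrow> int \<Rightarrow> int \<Rightarrow> nat \<Rightarrow> int set" where
  "bond_sites \<gamma> a b y =
     {a - 1..max (path_pos \<gamma> b (length \<gamma> - y)) (path_pos \<gamma> b (length \<gamma> - Suc y))}"

text \<open>
  The contraction of the folded network truncated at the open boundary \<open>a - 1\<close>, as a sum over the
  labellings \<open>\<beta>\<close> of all bonds which agree with the list \<open>\<omega>\<close> on the open legs.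
\<close>

definition influence_matrix ::
  "(int \<Rightarrow> nat \<Rightarrow> ('d::finite) gate) \<Rightarrow> ('d \<Rightarrow> 'd \<Rightarrow> complex) \<Rightarrow> int \<Rightarrow> int \<Rightarrow> int list \<Rightarrow>
     ('d \<times> 'd) list \<Rightarrow> complex" where
  "influence_matrix U m a b \<gamma> \<omega> =
     (let N = length \<gamma>; x = path_pos \<gamma> b in
      \<Sum>\<beta> | \<beta> \<in> (\<Pi>\<^sub>E y\<in>{0..N}. bond_sites \<gamma> a b y \<rightarrow>\<^sub>E UNIV) \<and>
           (\<forall>i\<in>{1..N}. \<beta> (N - i) (open_leg_site \<gamma> b i) = \<omega> ! (i - 1)).
        pair_tensor (fold_pair m) a (x N) (\<beta> 0) *
        (\<Prod>y\<in>{1..N}. row_tensor (\<lambda>x y. fold_gate (U x y)) a (x (N - y)) y (\<beta> y) (\<beta> (y - 1))) *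
        (\<Prod>k\<in>{a - 1..x 0}. loop_state (\<beta> N k)))"


section \<open>Entanglement of a vector with N legs\<close>

definition legs_of_length :: "nat \<Rightarrow> 'q list set" where
  "legs_of_length n = {\<omega>. length \<omega> = n}"

text \<open>
  Reduced density matrix on the first \<open>l\<close> of the \<open>N\<close> legs of the vector \<open>L\<close>, after normalisation;
  \<open>from_nat_into\<close> enumerates the basis, and no spectral quantity depends on the enumeration.
\<close>

definition reduced_density :: "nat \<Rightarrow> nat \<Rightarrow> (('q::finite) list \<Rightarrow> complex) \<Rightarrow> complex mat" where
  "reduced_density l N L =
     (let B = legs_of_length l; e = from_nat_into B
      in mat (card B) (card B) (\<lambda>(r, c).
           (\<Sum>s\<in>legs_of_length (N - l). L (e r @ s) * cnj (L (e c @ s))) /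
           of_real (\<Sum>\<omega>\<in>legs_of_length N. (cmod (L \<omega>))\<^sup>2)))"

text \<open>
  \<open>tr[\<rho>\<^sup>\<alpha>]\<close> for a positive semidefinite matrix: the sum of \<open>z\<^sup>\<alpha>\<close> over all eigenvalues \<open>z\<close>, counted
  with multiplicity.
\<close>

definition trace_powr :: "complex mat \<Rightarrow> real \<Rightarrow> real" where
  "trace_powr \<rho> \<alpha> = (\<Sum>z\<in>#proots (char_poly \<rho>). Re z powr \<alpha>)"

definition renyi_entropy :: "real \<Rightarrow> complex mat \<Rightarrow> real" where
  "renyi_entropy \<alpha> \<rho> = 1 / (1 - \<alpha>) * ln (trace_powr \<rho> \<alpha>)"

end

(*
  Contracting the top legs A of L_gamma with the loop state removes, by unitarity, all gates above
  the cut and leaves the influence matrix L_B of the remaining path. Hence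
  |L_B|^2 / |L_gamma|^2 is a Rayleigh quotient of rho_A, so it bounds the largest eigenvalue of rho_A
  from below and S^(alpha) from above.

  Exchanging two neighbouring steps (+1, -1) of the path adds or removes one gate at the open
  boundary, which acts on the two open legs as its dual gate. By dual unitarity this does not change
  the norm. All steps -1 can therefore be moved to the top, where each of them only contributes a
  normalised loop state. So |L_gamma|^2 depends only on the number tau of steps +1, and for the
  path +1, ..., +1 the gates outside the network act unitarily to the right of the cut, which gives
  |L_gamma|^2 = d^tau P(tau/2).
*)

theory Submission
  imports Defs "Jordan_Normal_Form.Spectral_Radius"
begin

section \<open>The largest eigenvalue of a positive semidefinite matrix\<close>

text \<open>The test vector is the product of loop states on the legs of A. Both L_gamma and L_B end
  at the same bottom point \<open>b\<close>, so their norms are purities of one and the same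
  circuit. Two obstacles shape the proof. The influence matrix is one sum over all bonds, whereas
  the arguments strip rows from the top or change two adjacent steps deep inside the path; this
  calls for a row recursion, \<open>net\<close>, that is linear in the part below. Moreover, closing
  legs and exchanging steps use only a few relations of the folded tensors, collected in
  \<open>solvable_network\<close>, while purity speaks about the unfolded circuit. The two meet in a
  Gram matrix Q of unfolded networks: closing the folded network with loops yields the entries of Q,
  so that |L|^2 is the sum of |Q|^2 up to a power of d. The half-line density is Q conjugated by an
  isometry, so its purity is that same sum.\<close>

lemma Re_mult_cnj_le:
  fixes x y :: complex
  assumes "t > 0"
  shows "2 * Re (x * cnj y) \<le> t * (cmod x)\<^sup>2 + (cmod y)\<^sup>2 / t"
proof -
  have "0 \<le> (cmod (of_real t * x - y))\<^sup>2" by simp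
  also have "\<dots> = t\<^sup>2 * (cmod x)\<^sup>2 + (cmod y)\<^sup>2 - t * (2 * Re (x * cnj y))"
    unfolding cmod_power2 by (simp add: power2_eq_square algebra_simps)
  finally have "2 * Re (x * cnj y) \<le> (t\<^sup>2 * (cmod x)\<^sup>2 + (cmod y)\<^sup>2) / t"
    using assms by (simp add: pos_le_divide_eq mult.commute)
  then show ?thesis using assms by (simp add: add_divide_distrib power2_eq_square)
qed

text \<open>Vectors are functions read only below the dimension, so that iterates are plain function
  powers and forms are plain sums.\<close>

definition apply_mat :: "complex mat \<Rightarrow> (nat \<Rightarrow> complex) \<Rightarrow> nat \<Rightarrow> complex" where
  "apply_mat A f i = (\<Sum>j<dim_col A. A $$ (i, j) * f j)"

text \<open>Links iteration to matrix powers, whose entries the spectral radius controls. The first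
  application is absorbed into the vector, hence the arbitrary \<open>v\<close> in the
  induction.\<close>

lemma funpow_apply_mat:
  assumes A: "A \<in> carrier_mat n n" and "i < n"
  shows "(apply_mat A ^^ k) v i = (\<Sum>j<n. (A ^\<^sub>m k) $$ (i, j) * v j)"
  using \<open>i < n\<close>
proof (induction k arbitrary: v i)
  case 0
  then show ?case using A by (simp add: one_mat_def if_distrib[of "\<lambda>x. x * _"] sum.delta cong: if_cong)
next
  case (Suc k)
  have pc: "A ^\<^sub>m k \<in> carrier_mat n n" using A by simp
  have "(apply_mat A ^^ Suc k) v i = (\<Sum>j<n. (A ^\<^sub>m k) $$ (i, j) * apply_mat A v j)"
    using Suc by (simp add: funpow_swap1)
  also have "\<dots> = (\<Sum>j<n. \<Sum>l<n. (A ^\<^sub>m k) $$ (i, j) * A $$ (j, l) * v l)"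
    using A by (simp add: apply_mat_def sum_distrib_left mult.assoc)
  also have "\<dots> = (\<Sum>l<n. (\<Sum>j<n. (A ^\<^sub>m k) $$ (i, j) * A $$ (j, l)) * v l)"
    by (subst sum.swap) (simp add: sum_distrib_right)
  also have "\<dots> = (\<Sum>l<n. (A ^\<^sub>m Suc k) $$ (i, l) * v l)"
    using Suc.prems A pc
    by (intro sum.cong refl) (simp add: scalar_prod_def atLeast0LessThan)
  finally show ?case .
qed

text \<open>
  For a Hermitian matrix the sequence of the norms of the iterates is logarithmically convex, so
  that it grows at least as fast as its first step.
\<close>

lemma rayleigh_le_1:
  assumes A: "A \<in> carrier_mat n n"
    and herm: "\<And>i j. i < n \<Longrightarrow> j < n \<Longrightarrow> A $$ (i, j) = cnj (A $$ (j, i))"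
    and sr: "spectral_radius A < 1"
  shows "Re (\<Sum>i<n. apply_mat A v i * cnj (v i)) \<le> (\<Sum>i<n. (cmod (v i))\<^sup>2)"
proof (rule ccontr)
  assume neg: "\<not> ?thesis"
  define w where "w k = (apply_mat A ^^ k) v" for k
  define s where "s k = (\<Sum>i<n. (cmod (w k i))\<^sup>2)" for k
  have s_nonneg: "s k \<ge> 0" for k unfolding s_def by (intro sum_nonneg) simp
  \<comment> \<open>The free weight \<open>t\<close> will be the expected growth factor, which takes
    the place of Cauchy-Schwarz.\<close>
  have Re_le: "2 * Re (\<Sum>i<n. f i * cnj (g i)) \<le>
      t * (\<Sum>i<n. (cmod (f i))\<^sup>2) + (\<Sum>i<n. (cmod (g i))\<^sup>2) / t" if "t > 0" for t f g
  proof -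
    have "2 * Re (\<Sum>i<n. f i * cnj (g i)) = (\<Sum>i<n. 2 * Re (f i * cnj (g i)))"
      by (simp only: Re_sum sum_distrib_left)
    also have "\<dots> \<le> (\<Sum>i<n. t * (cmod (f i))\<^sup>2 + (cmod (g i))\<^sup>2 / t)"
      by (intro sum_mono Re_mult_cnj_le that)
    finally show ?thesis by (simp only: sum.distrib sum_distrib_left sum_divide_distrib)
  qed
  have w0: "w 0 = v" and wS: "w (Suc k) = apply_mat A (w k)" for k by (simp_all add: w_def)
  have adj: "(\<Sum>i<n. apply_mat A f i * cnj (g i)) = (\<Sum>i<n. f i * cnj (apply_mat A g i))" for f g
  proof -
    have "(\<Sum>i<n. apply_mat A f i * cnj (g i)) = (\<Sum>i<n. \<Sum>j<n. A $$ (i, j) * f j * cnj (g i))"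
      using A by (simp add: apply_mat_def sum_distrib_right)
    also have "\<dots> = (\<Sum>j<n. \<Sum>i<n. f j * cnj (A $$ (j, i) * g i))"
    proof (subst sum.swap, intro sum.cong refl)
      fix i j assume "i \<in> {..<n}" "j \<in> {..<n}"
      then have "A $$ (j, i) = cnj (A $$ (i, j))" by (intro herm) auto
      then show "A $$ (j, i) * f i * cnj (g j) = f i * cnj (A $$ (i, j) * g j)" by simp
    qed
    also have "\<dots> = (\<Sum>i<n. f i * cnj (apply_mat A g i))"
      using A by (simp add: apply_mat_def sum_distrib_left)
    finally show ?thesis .
  qed
  have norm_eq: "(\<Sum>i<n. f i * cnj (f i)) = of_real (\<Sum>i<n. (cmod (f i))\<^sup>2)" for f
    by (simp only: of_real_sum complex_norm_square)
  define q where "q = Re (\<Sum>i<n. apply_mat A v i * cnj (v i)) / s 0"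
  have s0: "s 0 > 0"
  proof (rule ccontr)
    assume "\<not> s 0 > 0"
    then have "s 0 = 0" using s_nonneg[of 0] by simp
    then have "v i = 0" if "i < n" for i
      using that by (auto simp: s_def w0 sum_nonneg_eq_0_iff)
    then have "(\<Sum>i<n. apply_mat A v i * cnj (v i)) = 0" by simp
    then show False using neg by (simp add: sum_nonneg)
  qed
  have "s 0 < Re (\<Sum>i<n. apply_mat A v i * cnj (v i))" using neg by (simp only: s_def w0 not_le)
  then have q1: "q > 1" unfolding q_def using s0 by simp
  \<comment> \<open>The base case is <w 0, w 1> = q * s 0 with weight q. Afterwards <w k, w (k + 2)>
    = s (k + 1) with weight q^2, and the induction hypothesis absorbs the term in
    \<open>s k\<close>.\<close>
  have step: "s (Suc k) \<ge> q\<^sup>2 * s k" for k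
  proof (induction k)
    case 0
    have "2 * (q * s 0) \<le> q * s 0 + s (Suc 0) / q"
    proof -
      have "q * s 0 = Re (\<Sum>i<n. w 0 i * cnj (w (Suc 0) i))"
        unfolding wS adj[symmetric] using s0 by (simp add: q_def w0)
      then show ?thesis using Re_le[of q "w 0" "w (Suc 0)"] q1 by (simp add: s_def)
    qed
    then show ?case using q1 by (simp add: field_simps power2_eq_square)
  next
    case (Suc k)
    have "s (Suc k) = Re (\<Sum>i<n. w (Suc k) i * cnj (w (Suc k) i))"
      unfolding norm_eq s_def by simp
    also have "\<dots> = Re (\<Sum>i<n. w k i * cnj (w (Suc (Suc k)) i))"
      by (subst (1) wS) (simp only: adj wS)
    finally have "2 * s (Suc k) \<le> q\<^sup>2 * s k + s (Suc (Suc k)) / q\<^sup>2"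
      using Re_le[of "q\<^sup>2" "w k" "w (Suc (Suc k))"] q1 by (simp add: s_def)
    then have "s (Suc k) \<le> s (Suc (Suc k)) / q\<^sup>2" using Suc by simp
    then show ?case using q1 by (simp add: field_simps)
  qed
  have grow: "s k \<ge> (q\<^sup>2) ^ k * s 0" for k
  proof (induction k)
    case (Suc k)
    have "(q\<^sup>2) ^ Suc k * s 0 = q\<^sup>2 * ((q\<^sup>2) ^ k * s 0)" by simp
    also have "\<dots> \<le> q\<^sup>2 * s k" using Suc by (intro mult_left_mono) auto
    finally show ?case using step[of k] by simp
  qed simp
  \<comment> \<open>One constant bounds the entries of all powers, so \<open>s\<close> stays
    bounded, against its geometric growth.\<close>
  obtain C where C: "norm_bound (A ^\<^sub>m k) C" for k
    using spectral_radius_jnf_norm_bound_less_1_upper_triangular[OF A sr] by blast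
  have "s k \<le> (\<Sum>i<n. (\<Sum>j<n. C * cmod (v j))\<^sup>2)" for k
    unfolding s_def
  proof (intro sum_mono power_mono)
    fix i assume "i \<in> {..<n}"
    then have i: "i < n" by simp
    have "cmod (w k i) \<le> (\<Sum>j<n. cmod ((A ^\<^sub>m k) $$ (i, j) * v j))"
      unfolding w_def funpow_apply_mat[OF A i] by (rule norm_sum)
    also have "\<dots> \<le> (\<Sum>j<n. C * cmod (v j))"
      using C[of k] A i by (intro sum_mono) (auto simp: norm_mult norm_bound_def intro!: mult_right_mono)
    finally show "cmod (w k i) \<le> (\<Sum>j<n. C * cmod (v j))" .
  qed simp
  then have bd: "(q\<^sup>2) ^ k * s 0 \<le> (\<Sum>i<n. (\<Sum>j<n. C * cmod (v j))\<^sup>2)" for k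
    using grow[of k] order_trans by blast
  have "q\<^sup>2 > 1" using q1 by (simp add: one_less_power)
  then obtain k where "(\<Sum>i<n. (\<Sum>j<n. C * cmod (v j))\<^sup>2) / s 0 < (q\<^sup>2) ^ k"
    using real_arch_pow by blast
  then show False using bd[of k] s0 by (simp add: field_simps)
qed

text \<open>An eigenvalue of maximal modulus is real because the form is, and nonnegative by
  \<open>psd\<close>, hence equal to its modulus. Were the Rayleigh quotient larger than the
  spectral radius, rescaling by a number strictly between them would contradict
  \<open>rayleigh_le_1\<close>.\<close>

lemma ex_eigenvalue_ge_rayleigh:
  assumes A: "A \<in> carrier_mat n n"
    and herm: "\<And>i j. i < n \<Longrightarrow> j < n \<Longrightarrow> A $$ (i, j) = cnj (A $$ (j, i))"
    and psd: "\<And>f. 0 \<le> Re (\<Sum>i<n. apply_mat A f i * cnj (f i))"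
    and v: "0 < (\<Sum>i<n. (cmod (v i))\<^sup>2)"
  obtains z where "eigenvalue A z"
    and "Re (\<Sum>i<n. apply_mat A v i * cnj (v i)) / (\<Sum>i<n. (cmod (v i))\<^sup>2) \<le> Re z"
proof -
  have n: "n > 0" using v by (cases n) auto
  define q where "q = Re (\<Sum>i<n. apply_mat A v i * cnj (v i)) / (\<Sum>i<n. (cmod (v i))\<^sup>2)"
  obtain z where z: "eigenvalue A z" "cmod z = spectral_radius A"
    using spectral_radius_mem_max(1)[OF A n] by (auto simp: spectrum_def)
  have eig_real: "z = of_real (cmod z)"
  proof -
    obtain u where u: "u \<in> carrier_vec n" "u \<noteq> 0\<^sub>v n" "A *\<^sub>v u = z \<cdot>\<^sub>v u"
      using z(1) A unfolding eigenvalue_def eigenvector_def by auto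
    define N where "N = (\<Sum>i<n. (cmod (u $ i))\<^sup>2)"
    have Au: "apply_mat A (($) u) i = z * u $ i" if "i < n" for i
    proof -
      have "(A *\<^sub>v u) $ i = apply_mat A (($) u) i"
        using A u(1) that by (simp add: apply_mat_def scalar_prod_def atLeast0LessThan)
      then show ?thesis using u that by simp
    qed
    have form: "(\<Sum>i<n. apply_mat A (($) u) i * cnj (u $ i)) = z * of_real N"
      by (simp add: Au N_def sum_distrib_left mult.assoc complex_norm_square del: of_real_power)
    have "cnj (z * of_real N) = z * of_real N"
    proof -
      have "cnj (\<Sum>i<n. apply_mat A (($) u) i * cnj (u $ i))
          = (\<Sum>i<n. \<Sum>j<n. cnj (A $$ (i, j)) * cnj (u $ j) * u $ i)"
        using A by (simp add: apply_mat_def sum_distrib_right)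
      also have "\<dots> = (\<Sum>j<n. \<Sum>i<n. A $$ (j, i) * u $ i * cnj (u $ j))"
      proof (subst sum.swap, intro sum.cong refl)
        fix i j assume "i \<in> {..<n}" "j \<in> {..<n}"
        then have "A $$ (i, j) = cnj (A $$ (j, i))" by (intro herm) auto
        then show "cnj (A $$ (j, i)) * cnj (u $ i) * u $ j = A $$ (i, j) * u $ j * cnj (u $ i)" by simp
      qed
      also have "\<dots> = (\<Sum>i<n. apply_mat A (($) u) i * cnj (u $ i))"
        using A by (simp add: apply_mat_def sum_distrib_right)
      finally show ?thesis unfolding form .
    qed
    moreover have N: "N > 0"
    proof -
      obtain i where "i < n" "u $ i \<noteq> 0" using u(1,2) by (metis carrier_vecD eq_vecI index_zero_vec)
      then show ?thesis unfolding N_def by (intro sum_pos2[of _ i]) auto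
    qed
    ultimately have "Im z = 0" by (simp add: complex_eq_iff)
    moreover have "Re z \<ge> 0" using psd[of "($) u"] N unfolding form by (simp add: zero_le_mult_iff)
    ultimately show ?thesis by (simp add: complex_eq_iff cmod_def)
  qed
  have "q \<le> cmod z"
  proof (rule ccontr)
    assume "\<not> q \<le> cmod z"
    then obtain r where r: "cmod z < r" "r < q" using dense[of "cmod z" q] by auto
    have r0: "r > 0" using r(1) norm_ge_zero[of z] by linarith
    define B where "B = of_real (1 / r) \<cdot>\<^sub>m A"
    have B: "B \<in> carrier_mat n n" using A by (simp add: B_def)
    obtain y where y: "eigenvalue B y" "cmod y = spectral_radius B"
      using spectral_radius_mem_max(1)[OF B n] by (auto simp: spectrum_def)
    \<comment> \<open>Eigenvalues of \<open>B\<close> scale back to eigenvalues of \<open>A\<close>,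
      whose modulus is at most |z| < r.\<close>
    have "eigenvalue A (of_real r * y)"
    proof -
      obtain u where u: "u \<in> carrier_vec n" "u \<noteq> 0\<^sub>v n" "B *\<^sub>v u = y \<cdot>\<^sub>v u"
        using y(1) B unfolding eigenvalue_def eigenvector_def by auto
      have "A = of_real r \<cdot>\<^sub>m B" using r0 A by (intro eq_matI) (auto simp: B_def)
      then have "A *\<^sub>v u = of_real r \<cdot>\<^sub>v (B *\<^sub>v u)"
        using B u(1) by (auto simp: scalar_prod_def sum_distrib_left mult.assoc)
      then have "A *\<^sub>v u = (of_real r * y) \<cdot>\<^sub>v u" using u by (simp add: smult_smult_assoc)
      then show ?thesis using u A unfolding eigenvalue_def eigenvector_def by auto
    qed
    then have "cmod (of_real r * y) \<le> cmod z"
      using spectral_radius_mem_max(2)[OF A n, of "cmod (of_real r * y)"] z(2)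
      by (auto simp: spectrum_def)
    then have "r * cmod y \<le> cmod z" using r0 by (simp add: norm_mult)
    then have "r * cmod y < r * 1" using r(1) by linarith
    then have "spectral_radius B < 1" unfolding mult_less_cancel_left_pos[OF r0] y(2) .
    moreover have "B $$ (i, j) = cnj (B $$ (j, i))" if "i < n" "j < n" for i j
      using that A herm[OF that] by (simp add: B_def)
    ultimately have "Re (\<Sum>i<n. apply_mat B v i * cnj (v i)) \<le> (\<Sum>i<n. (cmod (v i))\<^sup>2)"
      by (intro rayleigh_le_1[OF B])
    also have "apply_mat B v i = of_real (1 / r) * apply_mat A v i" if "i < n" for i
      using that A by (simp add: apply_mat_def B_def sum_distrib_left)
    then have "(\<Sum>i<n. apply_mat B v i * cnj (v i)) = of_real (1 / r) * (\<Sum>i<n. apply_mat A v i * cnj (v i))"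
      unfolding sum_distrib_left by (intro sum.cong refl) (simp add: mult.assoc)
    finally have "q \<le> r" using v r0 by (simp add: q_def field_simps)
    then show False using r by simp
  qed
  then show ?thesis using that[of z] z(1) eig_real unfolding q_def by (metis Re_complex_of_real)
qed

section \<open>From a test vector to a bound on the Renyi entropy\<close>

lemma finite_legs_of_length [simp]: "finite (legs_of_length n :: 'q::finite list set)"
  using finite_lists_length_eq[of "UNIV :: 'q set" n] by (simp add: legs_of_length_def)

text \<open>\<open>W / Z\<close> is the Rayleigh quotient of the reduced density at the unit vector
  \<open>v\<close>, so some eigenvalue is at least \<open>W / Z\<close> and its power alone bounds
  \<open>trace_powr\<close> from below. The factor 1 / (1 - \<alpha>) is negative and reverses the
  inequality.\<close>

lemma renyi_entropy_reduced_density_le: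
  fixes L :: "'q::finite list \<Rightarrow> complex"
  assumes \<alpha>: "\<alpha> > 1" and L: "(\<Sum>\<omega>\<in>legs_of_length N. (cmod (L \<omega>))\<^sup>2) = Z" "Z > 0"
    and v: "(\<Sum>r\<in>legs_of_length l. (cmod (v r))\<^sup>2) = 1"
    and ov: "(\<Sum>s\<in>legs_of_length (N - l). (cmod (\<Sum>r\<in>legs_of_length l. cnj (v r) * L (r @ s)))\<^sup>2) = W"
            "W > 0"
  shows "renyi_entropy \<alpha> (reduced_density l N L) \<le> \<alpha> / (\<alpha> - 1) * ln (Z / W)"
proof -
  define B :: "'q list set" where "B = legs_of_length l"
  define e where "e = from_nat_into B"
  define n where "n = card B"
  define C :: "'q list set" where "C = legs_of_length (N - l)"
  define R where "R = reduced_density l N L"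
  have e: "bij_betw e {..<n} B"
    unfolding e_def n_def by (rule bij_betw_from_nat_into_finite) (simp add: B_def)
  have R: "R \<in> carrier_mat n n"
    unfolding R_def reduced_density_def by (simp add: Let_def n_def B_def)
  have R_entry: "R $$ (i, j) = (\<Sum>s\<in>C. L (e i @ s) * cnj (L (e j @ s))) / of_real Z"
    if "i < n" "j < n" for i j
    using that L(1) unfolding R_def reduced_density_def
    by (simp add: Let_def n_def B_def C_def e_def)
  \<comment> \<open>A sum of squared overlaps over the traced-out legs, which gives positivity and
    the Rayleigh quotient at once.\<close>
  have form: "(\<Sum>i<n. apply_mat R f i * cnj (f i)) =
      of_real ((\<Sum>s\<in>C. (cmod (\<Sum>i<n. cnj (f i) * L (e i @ s)))\<^sup>2) / Z)" for f
  proof -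
    have "(\<Sum>i<n. apply_mat R f i * cnj (f i)) =
        (\<Sum>i<n. \<Sum>j<n. (\<Sum>s\<in>C. L (e i @ s) * cnj (L (e j @ s)) * f j * cnj (f i)) / of_real Z)"
      using R unfolding apply_mat_def sum_distrib_right
      by (intro sum.cong refl) (auto simp: R_entry sum_distrib_right sum_divide_distrib)
    also have "\<dots> = (\<Sum>s\<in>C. \<Sum>i<n. \<Sum>j<n. L (e i @ s) * cnj (L (e j @ s)) * f j * cnj (f i)) / of_real Z"
      by (simp add: sum_divide_distrib sum.swap[of _ C])
    also have "\<dots> = (\<Sum>s\<in>C. of_real ((cmod (\<Sum>i<n. cnj (f i) * L (e i @ s)))\<^sup>2)) / of_real Z"
      unfolding complex_norm_square cnj_sum sum_product
      by (intro arg_cong2[of _ _ _ _ "(/)"] sum.cong refl) simp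
    finally show ?thesis by simp
  qed
  have B_sum: "(\<Sum>i<n. g (e i)) = (\<Sum>r\<in>B. g r)" for g :: "'q list \<Rightarrow> 'b::comm_monoid_add"
    using sum.reindex_bij_betw[OF e] .
  have v1: "(\<Sum>i<n. (cmod (v (e i)))\<^sup>2) = 1" using B_sum[of "\<lambda>r. (cmod (v r))\<^sup>2"] v by (simp add: B_def)
  have ray: "(\<Sum>i<n. apply_mat R (\<lambda>i. v (e i)) i * cnj (v (e i))) = of_real (W / Z)"
    unfolding form B_sum[of "\<lambda>r. cnj (v r) * L (r @ _)"] by (simp only: B_def C_def ov)
  have herm: "R $$ (i, j) = cnj (R $$ (j, i))" if "i < n" "j < n" for i j
    using that by (simp add: R_entry mult.commute)
  have "0 \<le> Re (\<Sum>i<n. apply_mat R f i * cnj (f i))" for f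
    unfolding form using L(2) by (simp add: sum_nonneg)
  from ex_eigenvalue_ge_rayleigh[OF R herm this, of "\<lambda>i. v (e i)"] obtain z
    where z: "eigenvalue R z" "W / Z \<le> Re z"
    unfolding ray v1 by (simp del: of_real_divide) blast
  \<comment> \<open>\<open>proots\<close> collects all roots only of a nonzero polynomial.\<close>
  have cp: "char_poly R \<noteq> 0" using degree_monic_char_poly[OF R] by auto
  have "z \<in># proots (char_poly R)"
    using z(1) eigenvalue_root_char_poly[OF R] cp by simp
  then obtain M where M: "proots (char_poly R) = add_mset z M" by (meson multi_member_split)
  have "(W / Z) powr \<alpha> \<le> Re z powr \<alpha>" using z(2) L(2) ov(2) \<alpha> by (intro powr_mono2) auto
  also have "\<dots> \<le> trace_powr R \<alpha>"
  proof -
    \<comment> \<open>A real \<open>powr\<close> is never negative, so the other eigenvalues can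
      only increase the trace.\<close>
    have "0 \<le> (\<Sum>z\<in>#M. Re z powr \<alpha>)" by (induction M) auto
    then show ?thesis by (simp add: trace_powr_def M)
  qed
  finally have "ln ((W / Z) powr \<alpha>) \<le> ln (trace_powr R \<alpha>)"
    using L(2) ov(2) by (subst ln_le_cancel_iff) (auto intro: less_le_trans[of 0 "(W / Z) powr \<alpha>"])
  then have "- ln (trace_powr R \<alpha>) \<le> \<alpha> * ln (Z / W)"
    using L(2) ov(2) by (simp add: ln_powr ln_div algebra_simps)
  then have "- ln (trace_powr R \<alpha>) / (\<alpha> - 1) \<le> \<alpha> * ln (Z / W) / (\<alpha> - 1)"
    using \<alpha> by (intro divide_right_mono) auto
  moreover have "renyi_entropy \<alpha> R = - ln (trace_powr R \<alpha>) / (\<alpha> - 1)"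
    unfolding renyi_entropy_def using \<alpha> by (simp add: field_simps)
  ultimately show ?thesis unfolding R_def by simp
qed

section \<open>Sums over configurations\<close>

lemma sum_PiE_insert:
  assumes "i \<notin> I"
  shows "(\<Sum>\<sigma>\<in>Pi\<^sub>E (insert i I) S. F \<sigma>) = (\<Sum>p\<in>S i. \<Sum>\<sigma>\<in>Pi\<^sub>E I S. F (\<sigma>(i := p)))"
  unfolding PiE_insert_eq sum.reindex[OF inj_combinator[OF assms]] sum.cartesian_product
  by (intro sum.cong refl) (auto simp: o_def)

lemma sum_PiE_union:
  assumes "I \<inter> J = {}"
  shows "(\<Sum>\<sigma>\<in>(I \<union> J) \<rightarrow>\<^sub>E S. F \<sigma>) =
    (\<Sum>\<tau>\<in>I \<rightarrow>\<^sub>E S. \<Sum>\<kappa>\<in>J \<rightarrow>\<^sub>E S. F (\<lambda>k. if k \<in> I then \<tau> k else \<kappa> k))"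
  unfolding sum.cartesian_product
  using assms
  by (intro sum.reindex_bij_witness
        [where i = "\<lambda>(\<tau>, \<kappa>) k. if k \<in> I then \<tau> k else \<kappa> k"
           and j = "\<lambda>\<sigma>. (restrict \<sigma> I, restrict \<sigma> J)"])
     (auto simp: fun_eq_iff PiE_def extensional_def Pi_def disjoint_iff intro!: arg_cong[of _ _ F])

lemma sum_PiE_Pair:
  "(\<Sum>\<sigma>\<in>I \<rightarrow>\<^sub>E (UNIV :: ('q \<times> 'q) set). F \<sigma>) =
   (\<Sum>\<sigma>\<in>I \<rightarrow>\<^sub>E (UNIV :: 'q set). \<Sum>\<sigma>'\<in>I \<rightarrow>\<^sub>E (UNIV :: 'q set). F (\<lambda>k\<in>I. (\<sigma> k, \<sigma>' k)))"
  unfolding sum.cartesian_product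
  by (intro sum.reindex_bij_witness
        [where i = "\<lambda>(\<sigma>, \<sigma>'). \<lambda>k\<in>I. (\<sigma> k, \<sigma>' k)"
           and j = "\<lambda>\<sigma>. (\<lambda>k\<in>I. fst (\<sigma> k), \<lambda>k\<in>I. snd (\<sigma> k))"])
     (auto simp: fun_eq_iff PiE_def extensional_def intro!: arg_cong[of _ _ F])

lemma sum_Pair_UNIV:
  "(\<Sum>p\<in>(UNIV :: ('a::finite \<times> 'b::finite) set). f p) = (\<Sum>x\<in>UNIV. \<Sum>y\<in>UNIV. f (x, y))"
  by (simp add: sum.cartesian_product)

text \<open>Every \<open>x\<close> in \<open>X\<close> owns the sites \<open>x - 1\<close> and
  \<open>x\<close>, and the conditions keep these blocks apart from each other and from
  \<open>K\<close>. The factors read disjoint labels, so the sum becomes a product of local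
  sums.\<close>

lemma sum_configs_factor:
  fixes f :: "int \<Rightarrow> 'q::finite \<Rightarrow> 'q \<Rightarrow> 'b::comm_semiring_1"
  assumes "finite X" "finite K" "\<And>x. x \<in> X \<Longrightarrow> x - 1 \<notin> X"
    and "\<And>x. x \<in> X \<Longrightarrow> x \<notin> K \<and> x - 1 \<notin> K"
  shows "(\<Sum>\<sigma>\<in>(K \<union> (\<Union>x\<in>X. {x - 1, x})) \<rightarrow>\<^sub>E UNIV.
            (\<Prod>x\<in>X. f x (\<sigma> (x - 1)) (\<sigma> x)) * (\<Prod>k\<in>K. h k (\<sigma> k))) =
         (\<Prod>x\<in>X. \<Sum>p\<in>UNIV. \<Sum>q\<in>UNIV. f x p q) * (\<Prod>k\<in>K. \<Sum>p\<in>UNIV. h k p)"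
  using assms(1,3,4)
proof (induction X)
  case empty
  then show ?case using prod_sum_PiE[of K "\<lambda>_. UNIV" h] assms(2) by simp
next
  case (insert x X)
  let ?D = "K \<union> (\<Union>x\<in>X. {x - 1, x})"
  let ?F = "\<lambda>\<sigma>. (\<Prod>x\<in>X. f x (\<sigma> (x - 1)) (\<sigma> x)) * (\<Prod>k\<in>K. h k (\<sigma> k))"
  \<comment> \<open>With both neighbours of \<open>x\<close> excluded, no other factor reads the two
    labels that are split off.\<close>
  have nX: "x + 1 \<notin> X" "x - 1 \<notin> X" using insert.prems(1)[of "x + 1"] insert.prems(1)[of x] by auto
  have nD: "x - 1 \<notin> insert x ?D" "x \<notin> ?D" using insert.prems nX insert.hyps by auto
  have "K \<union> (\<Union>x\<in>insert x X. {x - 1, x}) = insert (x - 1) (insert x ?D)" by auto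
  then have "(\<Sum>\<sigma>\<in>(K \<union> (\<Union>x\<in>insert x X. {x - 1, x})) \<rightarrow>\<^sub>E UNIV.
        (\<Prod>x\<in>insert x X. f x (\<sigma> (x - 1)) (\<sigma> x)) * (\<Prod>k\<in>K. h k (\<sigma> k)))
     = (\<Sum>p\<in>UNIV. \<Sum>q\<in>UNIV. \<Sum>\<sigma>\<in>?D \<rightarrow>\<^sub>E UNIV. f x p q * ?F (\<sigma>(x := q, x - 1 := p)))"
    using insert.hyps by (simp add: sum_PiE_insert[OF nD(1)] sum_PiE_insert[OF nD(2)] mult.assoc)
  also have "\<dots> = (\<Sum>p\<in>UNIV. \<Sum>q\<in>UNIV. \<Sum>\<sigma>\<in>?D \<rightarrow>\<^sub>E UNIV. f x p q * ?F \<sigma>)"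
    using insert.prems insert.hyps nX
    by (intro sum.cong refl arg_cong2[of _ _ _ _ "(*)"] prod.cong) auto
  also have "\<dots> = (\<Sum>p\<in>UNIV. \<Sum>q\<in>UNIV. f x p q) * (\<Sum>\<sigma>\<in>?D \<rightarrow>\<^sub>E UNIV. ?F \<sigma>)"
    unfolding sum_distrib_left[symmetric] sum_distrib_right ..
  finally show ?case using insert by (simp add: mult.assoc)
qed


section \<open>Rows of gates\<close>

lemma finite_gate_positions [simp]: "finite (gate_positions a r y)"
  by (rule finite_subset[of _ "{a..r}"]) (auto simp: gate_positions_def)

lemma finite_idle_sites [simp]: "finite (idle_sites a r y)"
  by (simp add: idle_sites_def)

lemma gate_positionsD:
  assumes "x \<in> gate_positions a r y"
  shows "x \<in> {a - 1..r}" "x - 1 \<in> {a - 1..r}" "x - 1 \<notin> gate_positions a r y"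
  using assms by (auto simp: gate_positions_def)

lemma idle_sitesD: "k \<in> idle_sites a r y \<Longrightarrow> k \<in> {a - 1..r}"
  by (simp add: idle_sites_def)

lemma sites_eq: "{a - 1..r} = idle_sites a r y \<union> (\<Union>x\<in>gate_positions a r y. {x - 1, x})"
  by (auto simp: idle_sites_def gate_positions_def)

text \<open>Serves every row-wise contraction: gates or pairs closed with loops, the norm of the
  pair state, a row composed with its adjoint.\<close>

lemma sum_row_factor:
  fixes f :: "int \<Rightarrow> 'q::finite \<Rightarrow> 'q \<Rightarrow> 'b::comm_semiring_1"
  shows "(\<Sum>\<sigma>\<in>{a - 1..r} \<rightarrow>\<^sub>E UNIV.
            (\<Prod>x\<in>gate_positions a r y. f x (\<sigma> (x - 1)) (\<sigma> x)) * (\<Prod>k\<in>idle_sites a r y. h k (\<sigma> k))) =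
         (\<Prod>x\<in>gate_positions a r y. \<Sum>p\<in>UNIV. \<Sum>q\<in>UNIV. f x p q) *
         (\<Prod>k\<in>idle_sites a r y. \<Sum>p\<in>UNIV. h k p)"
  by (subst sites_eq[of a r y], rule sum_configs_factor)
     (auto simp: idle_sites_def dest: gate_positionsD)

lemma prod_sites_factor:
  fixes g :: "int \<Rightarrow> 'b::comm_monoid_mult"
  shows "(\<Prod>k\<in>{a - 1..r}. g k) =
         (\<Prod>x\<in>gate_positions a r y. g (x - 1) * g x) * (\<Prod>k\<in>idle_sites a r y. g k)"
proof -
  have "(\<Prod>k\<in>{a - 1..r}. g k) =
      (\<Prod>k\<in>(\<Union>x\<in>gate_positions a r y. {x - 1, x}). g k) * (\<Prod>k\<in>idle_sites a r y. g k)"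
    by (subst sites_eq[of a r y], subst prod.union_disjoint) (auto simp: idle_sites_def mult.commute)
  also have "(\<Prod>k\<in>(\<Union>x\<in>gate_positions a r y. {x - 1, x}). g k) =
      (\<Prod>x\<in>gate_positions a r y. \<Prod>k\<in>{x - 1, x}. g k)"
  proof (rule prod.UNION_disjoint)
    show "\<forall>i\<in>gate_positions a r y. \<forall>j\<in>gate_positions a r y. i \<noteq> j \<longrightarrow> {i - 1, i} \<inter> {j - 1, j} = {}"
      using gate_positionsD(3) by fastforce
  qed auto
  finally show ?thesis by simp
qed

lemma row_tensor_cong:
  assumes "\<And>k. k \<in> {a - 1..r} \<Longrightarrow> \<sigma> k = \<rho> k" "\<And>k. k \<in> {a - 1..r} \<Longrightarrow> \<sigma>' k = \<rho>' k"
  shows "row_tensor G a r y \<sigma> \<sigma>' = row_tensor G a r y \<rho> \<rho>'"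
  unfolding row_tensor_def
  by (intro arg_cong2[of _ _ _ _ "(*)"] prod.cong refl)
     (simp_all only: assms[OF gate_positionsD(1)] assms[OF gate_positionsD(2)] assms[OF idle_sitesD])

lemma pair_tensor_cong:
  assumes "\<And>k. k \<in> {a - 1..r} \<Longrightarrow> \<sigma> k = \<rho> k"
  shows "pair_tensor M a r \<sigma> = pair_tensor M a r \<rho>"
  unfolding pair_tensor_def
  by (intro prod.cong refl) (simp only: assms[OF gate_positionsD(1)] assms[OF gate_positionsD(2)])

text \<open>A gate at \<open>r\<close> covers the sites \<open>r - 1\<close> and \<open>r\<close>,
  and the next position of that parity is \<open>r + 2\<close>. The cut between sites
  \<open>r\<close> and \<open>r + 1\<close> thus crosses no gate, and a right part with first
  position \<open>r + 2\<close> has first site \<open>r + 1\<close>.\<close>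

lemma gate_positions_split:
  assumes "even (r - int y)" "a \<le> r + 2" "r \<le> c"
  shows "gate_positions a c y = gate_positions a r y \<union> gate_positions (r + 2) c y"
    and "gate_positions a r y \<inter> gate_positions (r + 2) c y = {}"
proof -
  have "x \<noteq> r + 1" if "even (x - int y)" for x using that assms(1) by auto
  then show "gate_positions a c y = gate_positions a r y \<union> gate_positions (r + 2) c y"
    using assms(2,3) unfolding gate_positions_def by fastforce
qed (auto simp: gate_positions_def)

lemma row_tensor_split:
  assumes "even (r - int y)" "a \<le> r + 1" "r \<le> c"
  shows "row_tensor G a c y \<sigma> \<sigma>' = row_tensor G a r y \<sigma> \<sigma>' * row_tensor G (r + 2) c y \<sigma> \<sigma>'"
proof -
  note gp = gate_positions_split[OF assms(1) _ assms(3), of a]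
  have gu: "gate_positions a c y = gate_positions a r y \<union> gate_positions (r + 2) c y"
    using gp assms(2) by simp
  have su: "(\<Union>x\<in>gate_positions a r y. {x - 1, x}) \<subseteq> {a - 1..r}"
    "(\<Union>x\<in>gate_positions (r + 2) c y. {x - 1, x}) \<subseteq> {r + 1..c}"
    by (auto simp: gate_positions_def)
  have "{a - 1..c} = {a - 1..r} \<union> {r + 1..c}" using assms by auto
  then have idle: "idle_sites a c y = idle_sites a r y \<union> idle_sites (r + 2) c y"
    using su unfolding idle_sites_def gu by force
  have "idle_sites a r y \<inter> idle_sites (r + 2) c y = {}" by (auto simp: idle_sites_def)
  then show ?thesis
    using gp assms(2) unfolding row_tensor_def idle gu
    by (simp add: prod.union_disjoint mult_ac)
qed

lemma pair_tensor_split: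
  assumes "even r" "a \<le> r + 2" "r \<le> c"
  shows "pair_tensor M a c \<sigma> = pair_tensor M a r \<sigma> * pair_tensor M (r + 2) c \<sigma>"
  using gate_positions_split[of r 0 a c] assms
  unfolding pair_tensor_def by (simp add: prod.union_disjoint)

lemma row_tensor_single:
  assumes "even (x - int y)"
  shows "row_tensor G x x y \<sigma> \<sigma>' = G x y (\<sigma> (x - 1), \<sigma> x) (\<sigma>' (x - 1), \<sigma>' x)"
proof -
  have gp: "gate_positions x x y = {x}" using assms by (auto simp: gate_positions_def)
  have "idle_sites x x y = {}" unfolding idle_sites_def gp by auto
  then show ?thesis unfolding row_tensor_def gp by simp
qed

section \<open>Networks with an open boundary path\<close>

text \<open>An even site is the right member of the pair at its own position, an odd one the left
  member of the next pair.\<close>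

lemma idle_sites_0:
  assumes "even a" "even r"
  shows "idle_sites a r 0 = {}"
proof -
  have "\<exists>x\<in>gate_positions a r 0. k = x - 1 \<or> k = x" if k: "k \<in> {a - 1..r}" for k
  proof (cases "even k")
    case True
    then have "k \<noteq> a - 1" using assms by auto
    then have "k \<in> gate_positions a r 0" using True k by (auto simp: gate_positions_def)
    then show ?thesis by blast
  next
    case False
    then have "k \<noteq> r" using assms by auto
    then have "k + 1 \<in> gate_positions a r 0" using False k by (auto simp: gate_positions_def)
    then show ?thesis by (intro bexI[of _ "k + 1"]) auto
  qed
  then show ?thesis by (auto simp: idle_sites_def)
qed

text \<open>
  Partial contraction in which the bonds above the top row are still open (labels \<open>\<sigma>\<close>). The head of
  the path is its top step, so that the recursion adds one row on top; \<open>x\<close> is the position of the path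
  below that row.
\<close>

fun net :: "(int \<Rightarrow> nat \<Rightarrow> ('q::finite) gate) \<Rightarrow> ('q \<Rightarrow> 'q \<Rightarrow> complex) \<Rightarrow> int \<Rightarrow> int \<Rightarrow> int list \<Rightarrow>
    'q list \<Rightarrow> (int \<Rightarrow> 'q) \<Rightarrow> complex" where
  "net G M a b [] \<omega> \<sigma> = pair_tensor M a b \<sigma>"
| "net G M a b (g # \<gamma>) \<omega> \<sigma> =
     (let x = b - sum_list \<gamma>; y = Suc (length \<gamma>)
      in if g = 1
         then \<Sum>\<sigma>'\<in>{a - 1..x - 1} \<rightarrow>\<^sub>E UNIV.
                row_tensor G a (x - 1) y \<sigma> \<sigma>' * net G M a b \<gamma> (tl \<omega>) (\<sigma>'(x := hd \<omega>))
         else \<Sum>\<sigma>'\<in>{a - 1..x} \<rightarrow>\<^sub>E UNIV.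
                row_tensor G a (x + 1) y \<sigma> (\<sigma>'(x + 1 := hd \<omega>)) * net G M a b \<gamma> (tl \<omega>) \<sigma>')"

text \<open>The row above ends at \<open>x - 1\<close>, so the bond of site \<open>x\<close> coming
  from below stays open and carries \<open>p\<close>.\<close>

lemma net_plus:
  assumes "x = b - sum_list \<gamma>"
  shows "net G M a b (1 # \<gamma>) (p # \<omega>) \<sigma> =
    (\<Sum>\<sigma>'\<in>{a - 1..x - 1} \<rightarrow>\<^sub>E UNIV.
       row_tensor G a (x - 1) (Suc (length \<gamma>)) \<sigma> \<sigma>' * net G M a b \<gamma> \<omega> (\<sigma>'(x := p)))"
  using assms by (simp add: Let_def)

text \<open>The row above ends with the gate at \<open>x + 1\<close>; nothing lies below its
  bottom-right leg on site \<open>x + 1\<close>, which is fed with \<open>p\<close>.\<close>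

lemma net_minus:
  assumes "x = b - sum_list \<gamma>"
  shows "net G M a b (- 1 # \<gamma>) (p # \<omega>) \<sigma> =
    (\<Sum>\<sigma>'\<in>{a - 1..x} \<rightarrow>\<^sub>E UNIV.
       row_tensor G a (x + 1) (Suc (length \<gamma>)) \<sigma> (\<sigma>'(x + 1 := p)) * net G M a b \<gamma> \<omega> \<sigma>')"
  using assms by (simp add: Let_def)

declare net.simps(2) [simp del]

lemma net_cong:
  assumes "set \<gamma> \<subseteq> {1, - 1}" "\<And>k. k \<in> {a - 1..b - sum_list \<gamma>} \<Longrightarrow> \<sigma> k = \<rho> k"
  shows "net G M a b \<gamma> \<omega> \<sigma> = net G M a b \<gamma> \<omega> \<rho>"
proof (cases \<gamma>)
  case Nil
  then show ?thesis using pair_tensor_cong[of a b \<sigma> \<rho>] assms(2) by simp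
next
  case (Cons g \<gamma>')
  then have "g = 1 \<or> g = - 1" using assms(1) by auto
  then show ?thesis
  proof
    assume g: "g = 1"
    have "row_tensor G a (b - sum_list \<gamma>' - 1) y \<sigma> \<sigma>' = row_tensor G a (b - sum_list \<gamma>' - 1) y \<rho> \<sigma>'" for y \<sigma>'
      using assms(2) by (intro row_tensor_cong) (auto simp: Cons g)
    then show ?thesis by (simp add: Cons g net.simps(2) Let_def)
  next
    assume g: "g = - 1"
    have "row_tensor G a (b - sum_list \<gamma>' + 1) y \<sigma> \<sigma>' = row_tensor G a (b - sum_list \<gamma>' + 1) y \<rho> \<sigma>'" for y \<sigma>'
      using assms(2) by (intro row_tensor_cong) (auto simp: Cons g)
    then show ?thesis by (simp add: Cons g net.simps(2) Let_def)
  qed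
qed

text \<open>The rows of \<open>\<alpha>\<close> depend linearly on the part below. Equal sums and
  lengths put them at the same positions over both lower paths, so a local identity lifts to any
  depth.\<close>

lemma net_linear:
  assumes "sum_list \<gamma> = sum_list \<gamma>'" "length \<gamma> = length \<gamma>'" "length \<omega>\<alpha> = length \<alpha>"
    and "\<And>\<sigma>. net G M a b \<gamma> \<omega> \<sigma> = (\<Sum>i\<in>I. c i * net G M a b \<gamma>' (\<omega>' i) \<sigma>)"
  shows "net G M a b (\<alpha> @ \<gamma>) (\<omega>\<alpha> @ \<omega>) \<sigma> = (\<Sum>i\<in>I. c i * net G M a b (\<alpha> @ \<gamma>') (\<omega>\<alpha> @ \<omega>' i) \<sigma>)"
  using assms(3)
proof (induction \<alpha> arbitrary: \<omega>\<alpha> \<sigma>)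
  case Nil
  then show ?case using assms(4) by simp
next
  case (Cons g \<alpha>)
  then obtain p \<omega>1 where w: "\<omega>\<alpha> = p # \<omega>1" "length \<omega>1 = length \<alpha>" by (cases \<omega>\<alpha>) auto
  have swap: "(\<Sum>s\<in>S. f s * (\<Sum>i\<in>I. c i * h i s)) = (\<Sum>i\<in>I. c i * (\<Sum>s\<in>S. f s * h i s))"
    for S :: "(int \<Rightarrow> 'a) set" and f :: "(int \<Rightarrow> 'a) \<Rightarrow> complex" and h
    unfolding sum_distrib_left by (subst sum.swap) (simp add: mult_ac)
  show ?case
    by (simp add: net.simps(2) Let_def w Cons.IH[OF w(2)] assms(1,2) swap fun_upd_def)
qed

lemma sum_mult_swap:
  fixes P :: "'s \<Rightarrow> 'c::comm_semiring_0"
  shows "(\<Sum>s\<in>S. (\<Sum>t\<in>T. R s t * F t) * P s) = (\<Sum>t\<in>T. F t * (\<Sum>s\<in>S. R s t * P s))"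
  unfolding sum_distrib_left sum_distrib_right
  by (rule trans[OF sum.swap]) (simp only: mult_ac)

definition closed_net :: "('q \<Rightarrow> complex) \<Rightarrow> (int \<Rightarrow> nat \<Rightarrow> ('q::finite) gate) \<Rightarrow> ('q \<Rightarrow> 'q \<Rightarrow> complex) \<Rightarrow>
    int \<Rightarrow> int \<Rightarrow> int list \<Rightarrow> 'q list \<Rightarrow> complex" where
  "closed_net \<eta> G M a b \<gamma> \<omega> =
     (\<Sum>\<sigma>\<in>{a - 1..b - sum_list \<gamma>} \<rightarrow>\<^sub>E UNIV.
        net G M a b \<gamma> \<omega> \<sigma> * (\<Prod>k\<in>{a - 1..b - sum_list \<gamma>}. \<eta> (\<sigma> k)))"

section \<open>Parity and range of a path, sums over legs\<close>

lemma even_path_diff: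
  "set \<gamma> \<subseteq> {1, - 1} \<Longrightarrow> even (sum_list \<gamma> - int (length \<gamma>))"
  by (induction \<gamma>) auto

lemma abs_sum_list_le:
  "set \<gamma> \<subseteq> {1, - 1} \<Longrightarrow> \<bar>sum_list \<gamma>\<bar> \<le> int (length \<gamma>)"
  by (induction \<gamma>) auto

lemma sum_legs_0: "(\<Sum>\<omega>\<in>legs_of_length 0. f \<omega>) = f []"
  by (simp add: legs_of_length_def)

lemma sum_legs_append:
  "(\<Sum>\<omega>\<in>legs_of_length (m + n). f \<omega>) = (\<Sum>u\<in>legs_of_length m. \<Sum>v\<in>legs_of_length n. f (u @ v))"
  unfolding sum.cartesian_product
  by (rule sum.reindex_bij_witness[where i = "\<lambda>(u, v). u @ v" and j = "\<lambda>\<omega>. (take m \<omega>, drop m \<omega>)"])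
     (auto simp: legs_of_length_def)

lemma sum_legs_Suc:
  "(\<Sum>\<omega>\<in>legs_of_length (Suc n). f \<omega>) = (\<Sum>p\<in>UNIV. \<Sum>\<omega>\<in>legs_of_length n. f (p # \<omega>))"
  unfolding sum.cartesian_product
  by (rule sum.reindex_bij_witness[where i = "\<lambda>(p, \<omega>). p # \<omega>" and j = "\<lambda>\<omega>. (hd \<omega>, tl \<omega>)"])
     (auto simp: legs_of_length_def length_Suc_conv)

text \<open>Expanding the square leaves the Gram matrix of the rows of \<open>V\<close>, which is
  the identity. The index sets are arbitrary so that it covers the part right of the cut as well as
  single gates.\<close>

lemma sum_norm_isometry:
  fixes V :: "'i \<Rightarrow> 'j \<Rightarrow> complex"
  assumes "finite W"
    and "\<And>p q. p \<in> W \<Longrightarrow> q \<in> W \<Longrightarrow> (\<Sum>r\<in>R. V p r * cnj (V q r)) = of_bool (p = q)"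
  shows "(\<Sum>r\<in>R. (cmod (\<Sum>p\<in>W. V p r * f p))\<^sup>2) = (\<Sum>p\<in>W. (cmod (f p))\<^sup>2)"
proof -
  have "complex_of_real (\<Sum>r\<in>R. (cmod (\<Sum>p\<in>W. V p r * f p))\<^sup>2) =
      (\<Sum>r\<in>R. \<Sum>p\<in>W. \<Sum>q\<in>W. f p * cnj (f q) * (V p r * cnj (V q r)))"
    unfolding of_real_sum complex_norm_square cnj_sum sum_product
    by (intro sum.cong refl) (simp add: mult_ac)
  also have "\<dots> = (\<Sum>p\<in>W. \<Sum>q\<in>W. f p * cnj (f q) * (\<Sum>r\<in>R. V p r * cnj (V q r)))"
    unfolding sum_distrib_left
    by (rule trans[OF sum.swap], rule sum.cong[OF refl], rule sum.swap)
  also have "\<dots> = (\<Sum>p\<in>W. \<Sum>q\<in>W. if p = q then f p * cnj (f q) else 0)"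
    by (intro sum.cong refl) (simp add: assms(2))
  also have "\<dots> = (\<Sum>p\<in>W. f p * cnj (f p))"
    using assms(1) by simp
  also have "\<dots> = complex_of_real (\<Sum>p\<in>W. (cmod (f p))\<^sup>2)"
    by (simp only: of_real_sum complex_norm_square)
  finally show ?thesis by (simp only: of_real_eq_iff)
qed

lemma sum_norm_unitary:
  assumes "unitary V"
  shows "(\<Sum>r\<in>UNIV. (cmod (\<Sum>p\<in>UNIV. V p r * f p))\<^sup>2) = (\<Sum>p\<in>UNIV. (cmod (f p))\<^sup>2)"
  using assms by (intro sum_norm_isometry) (auto simp: unitary_def)

text \<open>For the folded circuit, \<open>\<eta>\<close> is the loop state.\<close>

locale solvable_network =
  fixes G :: "int \<Rightarrow> nat \<Rightarrow> ('q::finite) gate" and M :: "'q \<Rightarrow> 'q \<Rightarrow> complex"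
    and \<eta> :: "'q \<Rightarrow> complex" and a b :: int
  assumes close_gate: "\<And>x y i j. y \<ge> 1 \<Longrightarrow> even (x - int y) \<Longrightarrow>
      (\<Sum>k\<in>UNIV. \<Sum>l\<in>UNIV. G x y (k, l) (i, j) * (\<eta> k * \<eta> l)) = \<eta> i * \<eta> j"
    and dual_unitary_gate: "\<And>x y. y \<ge> 1 \<Longrightarrow> even (x - int y) \<Longrightarrow> unitary (dual_gate (G x y))"
    and close_pair: "(\<Sum>k\<in>UNIV. \<Sum>l\<in>UNIV. M k l * (\<eta> k * \<eta> l)) = 1"
    and loop_real: "\<And>p. cnj (\<eta> p) = \<eta> p"
    and loop_norm: "(\<Sum>p\<in>UNIV. (cmod (\<eta> p))\<^sup>2) = 1"
    and even_a: "even a" and even_b: "even b"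
begin

abbreviation "N \<equiv> net G M a b"
abbreviation "L \<equiv> closed_net \<eta> G M a b"

section \<open>Contraction with loop states\<close>

lemma loop_square: "(\<Sum>p\<in>UNIV. \<eta> p * \<eta> p) = 1"
proof -
  have "(\<Sum>p\<in>UNIV. \<eta> p * \<eta> p) = (\<Sum>p\<in>UNIV. of_real ((cmod (\<eta> p))\<^sup>2))"
    unfolding complex_norm_square loop_real ..
  also have "\<dots> = 1" unfolding of_real_sum[symmetric] loop_norm by simp
  finally show ?thesis .
qed

text \<open>Each gate is removed by \<open>close_gate\<close> and each idle site hands its loop
  down, so loops above a row become loops below it.\<close>

lemma close_row:
  assumes "y \<ge> 1"
  shows "(\<Sum>\<sigma>\<in>{a - 1..r} \<rightarrow>\<^sub>E UNIV. row_tensor G a r y \<sigma> \<sigma>' * (\<Prod>k\<in>{a - 1..r}. \<eta> (\<sigma> k))) =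
    (\<Prod>k\<in>{a - 1..r}. \<eta> (\<sigma>' k))"
proof -
  have "(\<Sum>\<sigma>\<in>{a - 1..r} \<rightarrow>\<^sub>E UNIV. row_tensor G a r y \<sigma> \<sigma>' * (\<Prod>k\<in>{a - 1..r}. \<eta> (\<sigma> k))) =
     (\<Sum>\<sigma>\<in>{a - 1..r} \<rightarrow>\<^sub>E UNIV.
        (\<Prod>x\<in>gate_positions a r y. G x y (\<sigma> (x - 1), \<sigma> x) (\<sigma>' (x - 1), \<sigma>' x) * (\<eta> (\<sigma> (x - 1)) * \<eta> (\<sigma> x))) *
        (\<Prod>k\<in>idle_sites a r y. of_bool (\<sigma> k = \<sigma>' k) * \<eta> (\<sigma> k)))"
    unfolding prod_sites_factor[of _ a r y] row_tensor_def prod.distrib by (simp only: mult_ac)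
  also have "\<dots> = (\<Prod>x\<in>gate_positions a r y. \<eta> (\<sigma>' (x - 1)) * \<eta> (\<sigma>' x)) *
      (\<Prod>k\<in>idle_sites a r y. \<eta> (\<sigma>' k))"
    unfolding sum_row_factor
      [where f = "\<lambda>x p q. G x y (p, q) (\<sigma>' (x - 1), \<sigma>' x) * (\<eta> p * \<eta> q)"
         and h = "\<lambda>k p. of_bool (p = \<sigma>' k) * \<eta> p"]
    using assms
    by (intro arg_cong2[of _ _ _ _ "(*)"] prod.cong refl close_gate)
       (auto simp: gate_positions_def of_bool_def if_distrib[of "\<lambda>x. x * _"] cong: if_cong)
  also have "\<dots> = (\<Prod>k\<in>{a - 1..r}. \<eta> (\<sigma>' k))" by (rule prod_sites_factor[symmetric])
  finally show ?thesis .
qed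

text \<open>Both ends are even, so every site lies in a pair and each pair closes to 1.\<close>

lemma closed_net_Nil: "L [] \<omega> = 1"
proof -
  have idle: "idle_sites a b 0 = {}" by (rule idle_sites_0) (use even_a even_b in auto)
  have "L [] \<omega> = (\<Sum>\<sigma>\<in>{a - 1..b} \<rightarrow>\<^sub>E UNIV.
      (\<Prod>x\<in>gate_positions a b 0. M (\<sigma> (x - 1)) (\<sigma> x) * (\<eta> (\<sigma> (x - 1)) * \<eta> (\<sigma> x))) *
      (\<Prod>k\<in>idle_sites a b 0. 1))"
    unfolding closed_net_def prod_sites_factor[of _ a _ 0]
    by (simp add: idle pair_tensor_def prod.distrib)
  also have "\<dots> = 1"
    unfolding sum_row_factor[where f = "\<lambda>x p q. M p q * (\<eta> p * \<eta> q)" and h = "\<lambda>k p. 1"]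
    by (simp add: close_pair idle)
  finally show ?thesis .
qed

text \<open>Once the top row is removed, loops sit on all sites up to \<open>x - 1\<close>; the loop
  on the open leg supplies the missing one at \<open>x\<close>.\<close>

lemma close_leg_plus:
  assumes a: "a \<le> b - sum_list \<gamma> + 1"
  shows "(\<Sum>p\<in>UNIV. \<eta> p * L (1 # \<gamma>) (p # \<omega>)) = L \<gamma> \<omega>"
proof -
  define x where "x = b - sum_list \<gamma>"
  have top: "b - sum_list (1 # \<gamma>) = x - 1" by (simp add: x_def)
  have "L (1 # \<gamma>) (p # \<omega>) = (\<Sum>\<sigma>'\<in>{a - 1..x - 1} \<rightarrow>\<^sub>E UNIV.
      N \<gamma> \<omega> (\<sigma>'(x := p)) * (\<Prod>k\<in>{a - 1..x - 1}. \<eta> (\<sigma>' k)))" for p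
    unfolding closed_net_def net_plus[OF x_def] top sum_mult_swap by (simp add: close_row)
  then have "(\<Sum>p\<in>UNIV. \<eta> p * L (1 # \<gamma>) (p # \<omega>)) =
      (\<Sum>p\<in>UNIV. \<Sum>\<sigma>'\<in>{a - 1..x - 1} \<rightarrow>\<^sub>E UNIV.
        N \<gamma> \<omega> (\<sigma>'(x := p)) * (\<eta> p * (\<Prod>k\<in>{a - 1..x - 1}. \<eta> (\<sigma>' k))))"
    by (simp add: sum_distrib_left mult_ac)
  also have "\<dots> = (\<Sum>p\<in>UNIV. \<Sum>\<sigma>'\<in>{a - 1..x - 1} \<rightarrow>\<^sub>E UNIV.
        N \<gamma> \<omega> (\<sigma>'(x := p)) * (\<Prod>k\<in>insert x {a - 1..x - 1}. \<eta> ((\<sigma>'(x := p)) k)))"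
    by (simp add: prod.insert)
  also have "\<dots> = L \<gamma> \<omega>"
  proof -
    have ins: "{a - 1..b - sum_list \<gamma>} = insert x {a - 1..x - 1}" using a by (auto simp: x_def)
    show ?thesis unfolding closed_net_def ins by (subst sum_PiE_insert) auto
  qed
  finally show ?thesis .
qed

text \<open>Removing the top row lowers the loop of site \<open>x + 1\<close> straight onto the open
  leg, which thereby decouples.\<close>

lemma closed_net_minus:
  assumes a: "a \<le> b - sum_list \<gamma> + 1"
  shows "L (- 1 # \<gamma>) (p # \<omega>) = \<eta> p * L \<gamma> \<omega>"
proof -
  define x where "x = b - sum_list \<gamma>"
  have top: "b - sum_list (- 1 # \<gamma>) = x + 1" by (simp add: x_def)
  have "L (- 1 # \<gamma>) (p # \<omega>) = (\<Sum>\<sigma>'\<in>{a - 1..x} \<rightarrow>\<^sub>E UNIV. N \<gamma> \<omega> \<sigma>' *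
      (\<Sum>\<sigma>\<in>{a - 1..x + 1} \<rightarrow>\<^sub>E UNIV. row_tensor G a (x + 1) (Suc (length \<gamma>)) \<sigma> (\<sigma>'(x + 1 := p)) *
         (\<Prod>k\<in>{a - 1..x + 1}. \<eta> (\<sigma> k))))"
    unfolding closed_net_def net_minus[OF x_def] top sum_mult_swap ..
  also have "\<dots> = (\<Sum>\<sigma>'\<in>{a - 1..x} \<rightarrow>\<^sub>E UNIV. N \<gamma> \<omega> \<sigma>' *
      (\<Prod>k\<in>insert (x + 1) {a - 1..x}. \<eta> ((\<sigma>'(x + 1 := p)) k)))"
  proof -
    have ins: "insert (x + 1) {a - 1..x} = {a - 1..x + 1}" using a by (auto simp: x_def)
    show ?thesis unfolding ins by (simp add: close_row)
  qed
  also have "\<dots> = \<eta> p * L \<gamma> \<omega>"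
    unfolding closed_net_def x_def[symmetric] sum_distrib_left
    by (intro sum.cong refl) (simp add: prod.insert mult_ac)
  finally show ?thesis .
qed

text \<open>The path with +1 above -1 encloses one more gate, at \<open>(x + 1, y)\<close>. Its
  right legs are the open legs \<open>q\<close> (top) and \<open>p\<close> (bottom); its left legs
  \<open>q'\<close> and \<open>p'\<close> are the open legs of the other path. Read sideways, this
  gate is \<open>dual_gate\<close>.\<close>

lemma net_swap:
  assumes \<gamma>: "set \<gamma> \<subseteq> {1, - 1}" and a: "a \<le> b - sum_list \<gamma>"
  shows "N (1 # - 1 # \<gamma>) (q # p # \<omega>) \<sigma> =
    (\<Sum>(q', p')\<in>UNIV. dual_gate (G (b - sum_list \<gamma> + 1) (Suc (length \<gamma>))) (q', p') (q, p) *
       N (- 1 # 1 # \<gamma>) (q' # p' # \<omega>) \<sigma>)"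
proof -
  define x where "x = b - sum_list \<gamma>"
  define y where "y = Suc (length \<gamma>)"
  let ?D = "{a - 1..x - 1} \<rightarrow>\<^sub>E (UNIV :: 'q set)"
  have par: "even (x + 1 - int y)"
    using even_path_diff[OF \<gamma>] even_b by (simp add: x_def y_def)
  have ax: "a \<le> x" using a by (simp add: x_def)
  then have ins: "{a - 1..x} = insert x {a - 1..x - 1}" by auto
  define T where "T \<tau> \<kappa> q' p' = row_tensor G a x (Suc y) \<sigma> (\<tau>(x := q')) *
      (row_tensor G a (x - 1) y \<tau> \<kappa> * N \<gamma> \<omega> (\<kappa>(x := p')))" for \<tau> \<kappa> q' p'
  have nx: "x \<notin> {a - 1..x - 1}" by simp
  \<comment> \<open>Row \<open>y\<close> ends at \<open>x + 1\<close> for one path and at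
    \<open>x - 1\<close> for the other; the difference is the single extra gate.\<close>
  have split: "row_tensor G a (x + 1) y (\<tau>(x := q', x + 1 := q)) (\<kappa>(x := p', x + 1 := p)) =
      row_tensor G a (x - 1) y \<tau> \<kappa> * G (x + 1) y (q', q) (p', p)" for \<tau> \<kappa> q' p'
  proof -
    have "row_tensor G a (x + 1) y (\<tau>(x := q', x + 1 := q)) (\<kappa>(x := p', x + 1 := p)) =
        row_tensor G a (x - 1) y (\<tau>(x := q', x + 1 := q)) (\<kappa>(x := p', x + 1 := p)) *
        G (x + 1) y (q', q) (p', p)"
      using row_tensor_split[of "x - 1" y a "x + 1" G] row_tensor_single[of "x + 1" y G] par ax
      by (simp add: add.commute[of 1])
    also have "row_tensor G a (x - 1) y (\<tau>(x := q', x + 1 := q)) (\<kappa>(x := p', x + 1 := p)) =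
        row_tensor G a (x - 1) y \<tau> \<kappa>"
      by (intro row_tensor_cong) auto
    finally show ?thesis .
  qed
  have "N (1 # - 1 # \<gamma>) (q # p # \<omega>) \<sigma> =
      (\<Sum>\<tau>\<in>{a - 1..x} \<rightarrow>\<^sub>E UNIV. row_tensor G a x (Suc y) \<sigma> \<tau> *
         (\<Sum>\<kappa>\<in>{a - 1..x} \<rightarrow>\<^sub>E UNIV. row_tensor G a (x + 1) y (\<tau>(x + 1 := q)) (\<kappa>(x + 1 := p)) * N \<gamma> \<omega> \<kappa>))"
    by (simp add: net_plus[of "x + 1"] net_minus[OF x_def] y_def x_def)
  \<comment> \<open>The bonds of site \<open>x\<close> above and below the extra gate are split off
    from the two row sums.\<close>
  also have "\<dots> = (\<Sum>q'\<in>UNIV. \<Sum>\<tau>\<in>?D. \<Sum>p'\<in>UNIV. \<Sum>\<kappa>\<in>?D.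
      G (x + 1) y (q', q) (p', p) * T \<tau> \<kappa> q' p')"
    unfolding ins sum_PiE_insert[OF nx] split T_def sum_distrib_left
    by (intro sum.cong refl) (simp only: mult_ac)
  also have "\<dots> = (\<Sum>q'\<in>UNIV. \<Sum>p'\<in>UNIV. \<Sum>\<tau>\<in>?D. \<Sum>\<kappa>\<in>?D.
      G (x + 1) y (q', q) (p', p) * T \<tau> \<kappa> q' p')"
    by (intro sum.cong refl sum.swap)
  also have "\<dots> = (\<Sum>q'\<in>UNIV. \<Sum>p'\<in>UNIV. G (x + 1) y (q', q) (p', p) * N (- 1 # 1 # \<gamma>) (q' # p' # \<omega>) \<sigma>)"
  proof -
    have "N (- 1 # 1 # \<gamma>) (q' # p' # \<omega>) \<sigma> = (\<Sum>\<tau>\<in>?D. \<Sum>\<kappa>\<in>?D. T \<tau> \<kappa> q' p')" for q' p'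
      by (simp add: net_plus[OF x_def] net_minus[of "x - 1"] y_def x_def T_def sum_distrib_left)
    then show ?thesis by (simp add: sum_distrib_left)
  qed
  finally show ?thesis
    by (simp add: sum.cartesian_product x_def y_def dual_gate_def case_prod_beta)
qed

lemma closed_net_swap:
  assumes \<gamma>: "set \<gamma> \<subseteq> {1, - 1}" and a: "a \<le> b - sum_list \<gamma>" and len: "length \<omega>\<alpha> = length \<alpha>"
  shows "L (\<alpha> @ 1 # - 1 # \<gamma>) (\<omega>\<alpha> @ q # p # \<omega>) =
    (\<Sum>r\<in>UNIV. dual_gate (G (b - sum_list \<gamma> + 1) (Suc (length \<gamma>))) r (q, p) *
       L (\<alpha> @ - 1 # 1 # \<gamma>) (\<omega>\<alpha> @ fst r # snd r # \<omega>))"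
proof -
  let ?V = "dual_gate (G (b - sum_list \<gamma> + 1) (Suc (length \<gamma>)))"
  have "N (\<alpha> @ 1 # - 1 # \<gamma>) (\<omega>\<alpha> @ q # p # \<omega>) \<sigma> =
    (\<Sum>r\<in>UNIV. ?V r (q, p) * N (\<alpha> @ - 1 # 1 # \<gamma>) (\<omega>\<alpha> @ fst r # snd r # \<omega>) \<sigma>)" for \<sigma>
    using net_swap[OF \<gamma> a] by (intro net_linear) (auto simp: len case_prod_beta)
  then show ?thesis
    unfolding closed_net_def
    by (simp add: sum_distrib_left sum_distrib_right) (subst sum.swap, simp add: mult_ac)
qed

section \<open>The norm under deformations of the path\<close>

definition norm2 :: "int list \<Rightarrow> real" where
  "norm2 \<gamma> = (\<Sum>\<omega>\<in>legs_of_length (length \<gamma>). (cmod (L \<gamma> \<omega>))\<^sup>2)"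

lemma norm2_swap:
  assumes \<gamma>: "set \<gamma> \<subseteq> {1, - 1}" and a: "a \<le> b - sum_list \<gamma>"
  shows "norm2 (\<alpha> @ 1 # - 1 # \<gamma>) = norm2 (\<alpha> @ - 1 # 1 # \<gamma>)"
proof -
  let ?V = "dual_gate (G (b - sum_list \<gamma> + 1) (Suc (length \<gamma>)))"
  have V: "unitary ?V"
    using even_path_diff[OF \<gamma>] even_b by (intro dual_unitary_gate) auto
  \<comment> \<open>The two exchanged legs are summed jointly and innermost, so that unitarity of
    \<open>?V\<close> applies with all other legs fixed.\<close>
  have expand: "norm2 (\<alpha> @ g # h # \<gamma>) =
      (\<Sum>u\<in>legs_of_length (length \<alpha>). \<Sum>\<omega>\<in>legs_of_length (length \<gamma>). \<Sum>r\<in>UNIV.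
        (cmod (L (\<alpha> @ g # h # \<gamma>) (u @ fst r # snd r # \<omega>)))\<^sup>2)" for g h
  proof -
    have len: "length (\<alpha> @ g # h # \<gamma>) = length \<alpha> + Suc (Suc (length \<gamma>))" by simp
    have "norm2 (\<alpha> @ g # h # \<gamma>) =
      (\<Sum>u\<in>legs_of_length (length \<alpha>). \<Sum>q\<in>UNIV. \<Sum>p\<in>UNIV. \<Sum>\<omega>\<in>legs_of_length (length \<gamma>).
        (cmod (L (\<alpha> @ g # h # \<gamma>) (u @ q # p # \<omega>)))\<^sup>2)"
      unfolding norm2_def len sum_legs_append sum_legs_Suc ..
    also have "\<dots> = (\<Sum>u\<in>legs_of_length (length \<alpha>). \<Sum>r\<in>UNIV. \<Sum>\<omega>\<in>legs_of_length (length \<gamma>).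
        (cmod (L (\<alpha> @ g # h # \<gamma>) (u @ fst r # snd r # \<omega>)))\<^sup>2)"
      by (simp add: sum_Pair_UNIV)
    finally show ?thesis by (simp add: sum.swap[of _ UNIV])
  qed
  have "(\<Sum>r\<in>UNIV. (cmod (L (\<alpha> @ 1 # - 1 # \<gamma>) (u @ fst r # snd r # \<omega>)))\<^sup>2) =
      (\<Sum>r\<in>UNIV. (cmod (L (\<alpha> @ - 1 # 1 # \<gamma>) (u @ fst r # snd r # \<omega>)))\<^sup>2)"
    if "length u = length \<alpha>" for u \<omega>
    using sum_norm_unitary[OF V, of "\<lambda>r. L (\<alpha> @ - 1 # 1 # \<gamma>) (u @ fst r # snd r # \<omega>)"]
    by (simp add: closed_net_swap[OF \<gamma> a that])
  note eq = this
  show ?thesis unfolding expand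
    by (rule sum.cong[OF refl], rule sum.cong[OF refl], rule eq) (simp add: legs_of_length_def)
qed

lemma norm2_minus:
  assumes "a \<le> b - sum_list \<gamma>"
  shows "norm2 (- 1 # \<gamma>) = norm2 \<gamma>"
proof -
  have "norm2 (- 1 # \<gamma>) = (\<Sum>p\<in>UNIV. (cmod (\<eta> p))\<^sup>2) * norm2 \<gamma>"
    using assms unfolding norm2_def sum_product
    by (simp add: sum_legs_Suc closed_net_minus norm_mult power_mult_distrib)
  then show ?thesis by (simp add: loop_norm)
qed

text \<open>Peeling \<open>\<alpha>\<close> from its lower end lifts the step -1 one place at a time
  until \<open>norm2_minus\<close> removes it. The bound uses the length because it then covers the
  sums of all suffixes met on the way.\<close>

lemma norm2_delete_minus:
  assumes "set (\<alpha> @ \<gamma>) \<subseteq> {1, - 1}" and "a \<le> b - int (length (\<alpha> @ \<gamma>))"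
  shows "norm2 (\<alpha> @ - 1 # \<gamma>) = norm2 (\<alpha> @ \<gamma>)"
  using assms
proof (induction \<alpha> arbitrary: \<gamma> rule: rev_induct)
  case Nil
  then show ?case using norm2_minus[of \<gamma>] abs_sum_list_le[of \<gamma>] by simp
next
  case (snoc g \<alpha>)
  have IH: "norm2 (\<alpha> @ - 1 # g # \<gamma>) = norm2 (\<alpha> @ g # \<gamma>)" using snoc by simp
  have "norm2 (\<alpha> @ g # - 1 # \<gamma>) = norm2 (\<alpha> @ - 1 # g # \<gamma>)"
    using snoc.prems norm2_swap[of \<gamma> \<alpha>] abs_sum_list_le[of \<gamma>] by auto
  then show ?case using IH by simp
qed

lemma norm2_eq_replicate:
  assumes "set \<gamma> \<subseteq> {1, - 1}" and "a \<le> b - int (length \<gamma>)"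
  shows "norm2 \<gamma> = norm2 (replicate (count_list \<gamma> 1) 1)"
proof -
  \<comment> \<open>The prefix collects the steps +1 already passed, below which the next -1 is
    deleted.\<close>
  have "norm2 (\<alpha> @ \<gamma>) = norm2 (\<alpha> @ replicate (count_list \<gamma> 1) 1)"
    if "set (\<alpha> @ \<gamma>) \<subseteq> {1, - 1}" "a \<le> b - int (length (\<alpha> @ \<gamma>))" for \<alpha>
    using that
  proof (induction \<gamma> arbitrary: \<alpha>)
    case (Cons g \<gamma>)
    show ?case
    proof (cases "g = 1")
      case True
      then show ?thesis using Cons.IH[of "\<alpha> @ [1]"] Cons.prems by simp
    next
      case False
      then have "g = - 1" using Cons.prems by auto
      then show ?thesis using Cons.IH[of \<alpha>] Cons.prems norm2_delete_minus[of \<alpha> \<gamma>] by simp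
    qed
  qed simp
  from this[of "[]"] assms show ?thesis by simp
qed

text \<open>Legs are closed from the top because unitarity removes rows only there; a leg of a step
  -1 is a loop contracted with itself. The conjugation, harmless for real loops, matches the overlap
  in the Rayleigh quotient.\<close>

lemma close_top_legs:
  assumes "set (\<alpha> @ \<gamma>) \<subseteq> {1, - 1}" and "a \<le> b - int (length (\<alpha> @ \<gamma>))"
  shows "(\<Sum>r\<in>legs_of_length (length \<alpha>). cnj (\<Prod>p\<leftarrow>r. \<eta> p) * L (\<alpha> @ \<gamma>) (r @ \<omega>)) = L \<gamma> \<omega>"
  using assms
proof (induction \<alpha>)
  case Nil
  then show ?case by (simp add: sum_legs_0)
next
  case (Cons g \<alpha>)
  have bnd: "a \<le> b - sum_list (\<alpha> @ \<gamma>) + 1"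
    using Cons.prems abs_sum_list_le[of "\<alpha> @ \<gamma>"] by auto
  have step: "(\<Sum>p\<in>UNIV. \<eta> p * L (g # \<alpha> @ \<gamma>) (p # r)) = L (\<alpha> @ \<gamma>) r" for r
  proof (cases "g = 1")
    case True
    then show ?thesis using close_leg_plus[OF bnd] by simp
  next
    case False
    then have "g = - 1" using Cons.prems by auto
    then show ?thesis
      by (simp add: closed_net_minus[OF bnd] mult.assoc[symmetric] sum_distrib_right[symmetric] loop_square)
  qed
  have "(\<Sum>r\<in>legs_of_length (length (g # \<alpha>)). cnj (\<Prod>p\<leftarrow>r. \<eta> p) * L ((g # \<alpha>) @ \<gamma>) (r @ \<omega>)) =
      (\<Sum>r\<in>legs_of_length (length \<alpha>). \<Sum>p\<in>UNIV. cnj (\<Prod>p\<leftarrow>r. \<eta> p) * (\<eta> p * L (g # \<alpha> @ \<gamma>) (p # r @ \<omega>)))"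
    by (simp add: sum_legs_Suc loop_real mult_ac) (rule sum.swap)
  also have "\<dots> = L \<gamma> \<omega>"
    using Cons by (simp add: sum_distrib_left[symmetric] step)
  finally show ?case .
qed

end

section \<open>The influence matrix as a closed network\<close>

text \<open>Transfer-matrix recursion, the bridge between one sum over all bonds and the row-by-row
  \<open>net\<close>.\<close>

primrec chain :: "('s \<Rightarrow> complex) \<Rightarrow> (nat \<Rightarrow> 's \<Rightarrow> 's \<Rightarrow> complex) \<Rightarrow> (nat \<Rightarrow> 's set) \<Rightarrow> nat \<Rightarrow> 's \<Rightarrow> complex" where
  "chain f K B 0 \<sigma> = f \<sigma>"
| "chain f K B (Suc n) \<sigma> = (\<Sum>\<sigma>'\<in>B n. K (Suc n) \<sigma> \<sigma>' * chain f K B n \<sigma>')"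

text \<open>The topmost label enters only the last kernel and \<open>g\<close>; after it is split
  off, both become the weight in the induction hypothesis, hence the arbitrary
  \<open>g\<close>.\<close>

lemma sum_chain:
  "(\<Sum>\<beta>\<in>(\<Pi>\<^sub>E y\<in>{0..n}. B y). f (\<beta> 0) * (\<Prod>y\<in>{1..n}. K y (\<beta> y) (\<beta> (y - 1))) * g (\<beta> n)) =
   (\<Sum>\<sigma>\<in>B n. chain f K B n \<sigma> * g \<sigma>)"
proof (induction n arbitrary: g)
  case 0
  have "(\<Sum>\<beta>\<in>(\<Pi>\<^sub>E y\<in>insert 0 {}. B y). f (\<beta> 0) * g (\<beta> 0)) = (\<Sum>\<sigma>\<in>B 0. f \<sigma> * g \<sigma>)"
    by (subst sum_PiE_insert) auto
  then show ?case by simp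
next
  case (Suc n)
  have ins: "{0..Suc n} = insert (Suc n) {0..n}" "{1..Suc n} = insert (Suc n) {1..n}" by auto
  have K: "(\<Prod>y\<in>{1..n}. K y ((\<beta>(Suc n := p)) y) ((\<beta>(Suc n := p)) (y - 1))) =
      (\<Prod>y\<in>{1..n}. K y (\<beta> y) (\<beta> (y - 1)))" for \<beta> p
    by (intro prod.cong refl) auto
  have "(\<Sum>\<beta>\<in>(\<Pi>\<^sub>E y\<in>{0..Suc n}. B y).
          f (\<beta> 0) * (\<Prod>y\<in>{1..Suc n}. K y (\<beta> y) (\<beta> (y - 1))) * g (\<beta> (Suc n))) =
      (\<Sum>p\<in>B (Suc n). \<Sum>\<beta>\<in>(\<Pi>\<^sub>E y\<in>{0..n}. B y).
          f (\<beta> 0) * (\<Prod>y\<in>{1..n}. K y (\<beta> y) (\<beta> (y - 1))) * (K (Suc n) p (\<beta> n) * g p))"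
    unfolding ins by (subst sum_PiE_insert) (simp_all add: K[simplified] mult_ac)
  also have "\<dots> = (\<Sum>p\<in>B (Suc n). \<Sum>\<sigma>\<in>B n. chain f K B n \<sigma> * (K (Suc n) p \<sigma> * g p))"
    by (intro sum.cong refl) (rule Suc.IH)
  also have "\<dots> = (\<Sum>p\<in>B (Suc n). chain f K B (Suc n) p * g p)"
    by (simp add: sum_distrib_right mult.assoc mult.left_commute)
  finally show ?case .
qed

lemma sum_PiE_fixed:
  assumes "i \<notin> I"
  shows "(\<Sum>\<sigma>\<in>{\<sigma> \<in> insert i I \<rightarrow>\<^sub>E UNIV. \<sigma> i = p}. F \<sigma>) = (\<Sum>\<sigma>\<in>I \<rightarrow>\<^sub>E UNIV. F (\<sigma>(i := p)))"
  using assms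
  by (intro sum.reindex_bij_witness[where i = "\<lambda>\<sigma>. \<sigma>(i := p)" and j = "\<lambda>\<sigma>. restrict \<sigma> I"])
     (auto simp: fun_eq_iff PiE_def extensional_def intro!: arg_cong[of _ _ F])

text \<open>Every bond level below \<open>N\<close> carries exactly one open leg, so the constraints
  by \<open>\<omega>\<close> distribute over the levels and the sum over all bonds is a
  chain.\<close>

lemma influence_matrix_eq_closed_net:
  fixes U :: "int \<Rightarrow> nat \<Rightarrow> ('d::finite) gate"
  assumes \<gamma>: "set \<gamma> \<subseteq> {1, - 1}" and a: "a \<le> b - int (length \<gamma>)" and \<omega>: "length \<omega> = length \<gamma>"
  shows "influence_matrix U m a b \<gamma> \<omega> =
    closed_net loop_state (\<lambda>x y. fold_gate (U x y)) (fold_pair m) a b \<gamma> \<omega>"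
proof -
  define N where "N = length \<gamma>"
  define x where "x = path_pos \<gamma> b"
  define G where "G = (\<lambda>x y. fold_gate (U x y))"
  define K where "K y = row_tensor G a (x (N - y)) y" for y
  \<comment> \<open>Level \<open>y\<close> carries leg \<open>N - y\<close>; the bonds above row
    \<open>N\<close> carry none, hence the guard.\<close>
  define B where "B y = {f \<in> bond_sites \<gamma> a b y \<rightarrow>\<^sub>E UNIV.
      y < N \<longrightarrow> f (open_leg_site \<gamma> b (N - y)) = \<omega> ! (N - y - 1)}" for y
  let ?f = "pair_tensor (fold_pair m) a (x N)"
  let ?g = "\<lambda>\<sigma>. \<Prod>k\<in>{a - 1..x 0}. loop_state (\<sigma> k)"
  have xn: "x i = b - sum_list (drop i \<gamma>)" for i by (simp add: x_def path_pos_def)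
  have dom: "{\<beta>. \<beta> \<in> (\<Pi>\<^sub>E y\<in>{0..N}. bond_sites \<gamma> a b y \<rightarrow>\<^sub>E UNIV) \<and>
        (\<forall>i\<in>{1..N}. \<beta> (N - i) (open_leg_site \<gamma> b i) = \<omega> ! (i - 1))} = (\<Pi>\<^sub>E y\<in>{0..N}. B y)"
    (is "?S = ?T")
  proof (intro equalityI subsetI)
    fix \<beta> assume \<beta>: "\<beta> \<in> ?S"
    have "\<beta> y (open_leg_site \<gamma> b (N - y)) = \<omega> ! (N - y - 1)" if "y < N" for y
    proof -
      have "N - y \<in> {1..N}" "N - (N - y) = y" using that by auto
      then show ?thesis using \<beta> by force
    qed
    then show "\<beta> \<in> ?T" using \<beta> by (auto simp: B_def PiE_iff)
  next
    fix \<beta> assume \<beta>: "\<beta> \<in> ?T"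
    have "\<beta> (N - i) (open_leg_site \<gamma> b i) = \<omega> ! (i - 1)" if "i \<in> {1..N}" for i
    proof -
      have "\<beta> (N - i) \<in> B (N - i)" using \<beta> by (auto simp: PiE_iff)
      moreover have "N - i < N" "N - (N - i) = i" using that by auto
      ultimately show ?thesis by (simp add: B_def)
    qed
    then show "\<beta> \<in> ?S" using \<beta> by (auto simp: B_def PiE_iff)
  qed
  \<comment> \<open>Paths are listed from the top, so the rows up to \<open>n\<close> belong to the
    last \<open>n\<close> steps.\<close>
  have chain: "chain ?f K B n \<sigma> = net G (fold_pair m) a b (drop (N - n) \<gamma>) (drop (N - n) \<omega>) \<sigma>"
    if "n \<le> N" for n \<sigma>
    using that
  proof (induction n arbitrary: \<sigma>)
    case 0
    then show ?case by (simp add: N_def xn)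
  next
    case (Suc n)
    define i where "i = N - Suc n"
    have i: "i < N" "N - n = Suc i" using Suc.prems by (auto simp: i_def)
    define g where "g = \<gamma> ! i"
    define \<gamma>' where "\<gamma>' = drop (Suc i) \<gamma>"
    define \<omega>' where "\<omega>' = drop (Suc i) \<omega>"
    define X where "X = b - sum_list \<gamma>'"
    have d\<gamma>: "drop i \<gamma> = g # \<gamma>'" and d\<omega>: "drop i \<omega> = \<omega> ! i # \<omega>'"
      using i(1) \<omega> by (auto simp: g_def \<gamma>'_def \<omega>'_def N_def Cons_nth_drop_Suc)
    have set\<gamma>': "set \<gamma>' \<subseteq> {1, - 1}" using \<gamma> set_drop_subset[of "Suc i" \<gamma>] by (auto simp: \<gamma>'_def)
    have len\<gamma>': "length \<gamma>' = n" using Suc.prems by (simp add: \<gamma>'_def i_def N_def)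
    have aX: "a \<le> X"
      using abs_sum_list_le[OF set\<gamma>'] a Suc.prems by (simp add: X_def len\<gamma>' N_def)
    have pos: "path_pos \<gamma> b (Suc i) = X" "path_pos \<gamma> b i = X - g"
      by (simp_all add: path_pos_def \<gamma>'_def[symmetric] d\<gamma> X_def)
    \<comment> \<open>The last bond belongs to whichever adjacent row reaches further right, and it
      is the open one.\<close>
    have bond: "bond_sites \<gamma> a b n = {a - 1..max X (X - g)}"
      unfolding bond_sites_def N_def[symmetric] i(2) i_def[symmetric] pos ..
    have leg: "open_leg_site \<gamma> b (N - n) = (if g = 1 then X else X - g)"
      unfolding open_leg_site_def i(2) by (simp add: pos g_def)
    have IH: "chain ?f K B n \<sigma>' = net G (fold_pair m) a b \<gamma>' \<omega>' \<sigma>'" for \<sigma>'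
      using Suc.IH[of \<sigma>'] Suc.prems by (simp add: i(2) \<gamma>'_def \<omega>'_def)
    have K: "K (Suc n) = row_tensor G a (X - g) (Suc n)"
      unfolding K_def i_def[symmetric] x_def pos ..
    have "g \<in> set \<gamma>" using nth_mem[of i \<gamma>] i(1) by (simp add: g_def N_def)
    then have "g = 1 \<or> g = - 1" using \<gamma> by blast
    then show ?case
    proof
      assume g: "g = 1"
      have ins: "{a - 1..X} = insert X {a - 1..X - 1}" using aX by auto
      have B: "B n = {f \<in> insert X {a - 1..X - 1} \<rightarrow>\<^sub>E UNIV. f X = \<omega> ! i}"
        using Suc.prems unfolding B_def bond leg ins[symmetric] g by (simp add: i(2))
      have "chain ?f K B (Suc n) \<sigma> = (\<Sum>\<sigma>'\<in>{a - 1..X - 1} \<rightarrow>\<^sub>E UNIV.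
          row_tensor G a (X - 1) (Suc n) \<sigma> (\<sigma>'(X := \<omega> ! i)) *
          net G (fold_pair m) a b \<gamma>' \<omega>' (\<sigma>'(X := \<omega> ! i)))"
        unfolding chain.simps B by (subst sum_PiE_fixed) (simp_all add: IH K g)
      \<comment> \<open>The row above ends at \<open>X - 1\<close> and does not read the open leg.
        For a step -1 it is the lower net, ending at \<open>X\<close>, that does not read
        it.\<close>
      also have "\<dots> = net G (fold_pair m) a b (1 # \<gamma>') (\<omega> ! i # \<omega>') \<sigma>"
        unfolding net_plus[OF X_def] len\<gamma>'
        by (intro sum.cong refl arg_cong2[of _ _ _ _ "(*)"] row_tensor_cong) auto
      finally show ?thesis by (simp add: i_def[symmetric] d\<gamma> d\<omega> g)
    next
      assume g: "g = - 1"
      have ins: "{a - 1..X + 1} = insert (X + 1) {a - 1..X}" using aX by auto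
      have B: "B n = {f \<in> insert (X + 1) {a - 1..X} \<rightarrow>\<^sub>E UNIV. f (X + 1) = \<omega> ! i}"
        using Suc.prems unfolding B_def bond leg ins[symmetric] g by (simp add: i(2))
      have "chain ?f K B (Suc n) \<sigma> = (\<Sum>\<sigma>'\<in>{a - 1..X} \<rightarrow>\<^sub>E UNIV.
          row_tensor G a (X + 1) (Suc n) \<sigma> (\<sigma>'(X + 1 := \<omega> ! i)) *
          net G (fold_pair m) a b \<gamma>' \<omega>' (\<sigma>'(X + 1 := \<omega> ! i)))"
        unfolding chain.simps B by (subst sum_PiE_fixed) (simp_all add: IH K g)
      also have "\<dots> = net G (fold_pair m) a b (- 1 # \<gamma>') (\<omega> ! i # \<omega>') \<sigma>"
        unfolding net_minus[OF X_def] len\<gamma>'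
        by (intro sum.cong refl arg_cong2[of _ _ _ _ "(*)"] net_cong set\<gamma>') (auto simp: X_def)
      finally show ?thesis by (simp add: i_def[symmetric] d\<gamma> d\<omega> g)
    qed
  qed
  have BN: "B N = {a - 1..x 0} \<rightarrow>\<^sub>E UNIV"
    by (simp add: B_def bond_sites_def N_def x_def)
  have "influence_matrix U m a b \<gamma> \<omega> =
      (\<Sum>\<beta>\<in>(\<Pi>\<^sub>E y\<in>{0..N}. B y). ?f (\<beta> 0) * (\<Prod>y\<in>{1..N}. K y (\<beta> y) (\<beta> (y - 1))) * ?g (\<beta> N))"
    unfolding influence_matrix_def Let_def N_def[symmetric] x_def[symmetric] G_def[symmetric] dom K_def ..
  also have "\<dots> = (\<Sum>\<sigma>\<in>B N. chain ?f K B N \<sigma> * ?g \<sigma>)" by (rule sum_chain)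
  also have "\<dots> = closed_net loop_state G (fold_pair m) a b \<gamma> \<omega>"
    unfolding BN closed_net_def using chain[of N] by (simp add: xn[of 0])
  finally show ?thesis by (simp add: G_def)
qed

section \<open>Unfolding\<close>

lemma cnj_of_bool [simp]: "cnj (of_bool P) = of_bool P"
  by (cases P) auto

lemma row_tensor_fold:
  "row_tensor (\<lambda>x y. fold_gate (U x y)) a r y (\<lambda>k. (\<sigma> k, \<sigma>' k)) (\<lambda>k. (\<rho> k, \<rho>' k)) =
   row_tensor U a r y \<sigma> \<rho> * cnj (row_tensor U a r y \<sigma>' \<rho>')"
  unfolding row_tensor_def
  by (simp add: fold_gate_def prod.distrib of_bool_conj mult_ac)

text \<open>Each tensor is a factor on the first copy times a conjugate factor on the second, so the
  double sum over inner labels factorises.\<close>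

lemma net_fold:
  assumes "set \<gamma> \<subseteq> {1, - 1}" "length \<omega> = length \<gamma>" "length \<omega>' = length \<gamma>"
  shows "net (\<lambda>x y. fold_gate (U x y)) (fold_pair m) a b \<gamma> (zip \<omega> \<omega>') (\<lambda>k. (\<sigma> k, \<sigma>' k)) =
    net U m a b \<gamma> \<omega> \<sigma> * cnj (net U m a b \<gamma> \<omega>' \<sigma>')"
  using assms
proof (induction \<gamma> arbitrary: \<omega> \<omega>' \<sigma> \<sigma>')
  case Nil
  then show ?case by (simp add: pair_tensor_def fold_pair_def prod.distrib)
next
  case (Cons g \<gamma>)
  let ?G = "\<lambda>x y. fold_gate (U x y)"
  let ?R = "\<lambda>r. row_tensor ?G a r (Suc (length \<gamma>))"
  let ?N = "net ?G (fold_pair m) a b \<gamma>"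
  define x where "x = b - sum_list \<gamma>"
  obtain p w p' w' where w: "\<omega> = p # w" "\<omega>' = p' # w'" "length w = length \<gamma>" "length w' = length \<gamma>"
    using Cons.prems by (cases \<omega>; cases \<omega>') auto
  have set\<gamma>: "set \<gamma> \<subseteq> {1, - 1}" using Cons.prems by simp
  note IH = Cons.IH[OF set\<gamma> w(3,4)]
  have "g = 1 \<or> g = - 1" using Cons.prems by auto
  then show ?case
  proof
    assume g: "g = 1"
    \<comment> \<open>Outside the summation range the restricted labelling is
      \<open>undefined\<close> instead of a pair of labels; neither tensor reads it there.\<close>
    have "?R (x - 1) (\<lambda>k. (\<sigma> k, \<sigma>' k)) (\<lambda>k\<in>{a - 1..x - 1}. (\<tau> k, \<tau>' k)) *
        ?N (zip w w') ((\<lambda>k\<in>{a - 1..x - 1}. (\<tau> k, \<tau>' k))(x := (p, p'))) =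
        ?R (x - 1) (\<lambda>k. (\<sigma> k, \<sigma>' k)) (\<lambda>k. (\<tau> k, \<tau>' k)) *
        ?N (zip w w') (\<lambda>k. ((\<tau>(x := p)) k, (\<tau>'(x := p')) k))" for \<tau> \<tau>'
      by (intro arg_cong2[of _ _ _ _ "(*)"] row_tensor_cong net_cong set\<gamma>) (auto simp: x_def)
    then show ?thesis
      unfolding w zip_Cons_Cons g net_plus[OF x_def] sum_PiE_Pair cnj_sum sum_product
      by (simp only: row_tensor_fold IH complex_cnj_mult) (simp only: mult_ac)
  next
    assume g: "g = - 1"
    have "?R (x + 1) (\<lambda>k. (\<sigma> k, \<sigma>' k)) ((\<lambda>k\<in>{a - 1..x}. (\<tau> k, \<tau>' k))(x + 1 := (p, p'))) *
        ?N (zip w w') (\<lambda>k\<in>{a - 1..x}. (\<tau> k, \<tau>' k)) =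
        ?R (x + 1) (\<lambda>k. (\<sigma> k, \<sigma>' k)) (\<lambda>k. ((\<tau>(x + 1 := p)) k, (\<tau>'(x + 1 := p')) k)) *
        ?N (zip w w') (\<lambda>k. (\<tau> k, \<tau>' k))" for \<tau> \<tau>'
      by (intro arg_cong2[of _ _ _ _ "(*)"] row_tensor_cong net_cong set\<gamma>) (auto simp: x_def)
    then show ?thesis
      unfolding w zip_Cons_Cons g net_minus[OF x_def] sum_PiE_Pair cnj_sum sum_product
      by (simp only: row_tensor_fold IH complex_cnj_mult) (simp only: mult_ac)
  qed
qed

text \<open>One factor per initial pair: the influence matrix is built from \<open>m\<close>, the
  evolved state from its normalised version.\<close>

lemma net_scale:
  "net U (\<lambda>i j. m i j / s) a b \<gamma> \<omega> \<sigma> = net U m a b \<gamma> \<omega> \<sigma> / s ^ card (gate_positions a b 0)"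
proof (induction \<gamma> arbitrary: \<omega> \<sigma>)
  case Nil
  then show ?case by (simp add: pair_tensor_def prod_dividef)
next
  case (Cons g \<gamma>)
  show ?case by (simp add: net.simps(2) Let_def Cons.IH sum_divide_distrib fun_upd_def)
qed

lemma prod_of_bool_eq:
  assumes "\<tau> \<in> I \<rightarrow>\<^sub>E UNIV" "\<tau>' \<in> I \<rightarrow>\<^sub>E UNIV" "finite I"
  shows "(\<Prod>k\<in>I. of_bool (\<tau> k = \<tau>' k)) = (of_bool (\<tau> = \<tau>') :: 'b::comm_semiring_1)"
proof (cases "\<tau> = \<tau>'")
  case False
  then obtain k where "k \<in> I" "\<tau> k \<noteq> \<tau>' k" using PiE_ext[OF assms(1,2)] by blast
  then have "(\<Prod>k\<in>I. of_bool (\<tau> k = \<tau>' k)) = (0 :: 'b)"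
    by (intro prod_zero[OF assms(3)]) auto
  then show ?thesis using False by simp
qed simp

text \<open>Loops identify the top labels of the two copies, at the price of an inverse square root
  of d per site. What remains is the Gram matrix of the unfolded networks, indexed by their open
  legs.\<close>

lemma closed_net_fold:
  fixes U :: "int \<Rightarrow> nat \<Rightarrow> ('d::finite) gate" and a b :: int
  assumes "set \<gamma> \<subseteq> {1, - 1}" "length \<omega> = length \<gamma>" "length \<omega>' = length \<gamma>"
  defines "I \<equiv> {a - 1..b - sum_list \<gamma>}"
  shows "closed_net loop_state (\<lambda>x y. fold_gate (U x y)) (fold_pair m) a b \<gamma> (zip \<omega> \<omega>') =
    (\<Sum>\<tau>\<in>I \<rightarrow>\<^sub>E UNIV. net U m a b \<gamma> \<omega> \<tau> * cnj (net U m a b \<gamma> \<omega>' \<tau>)) /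
    of_real (sqrt (real CARD('d))) ^ card I"
proof -
  let ?N = "net (\<lambda>x y. fold_gate (U x y)) (fold_pair m) a b \<gamma> (zip \<omega> \<omega>')"
  let ?s = "of_real (sqrt (real CARD('d))) :: complex"
  have N: "?N (\<lambda>k\<in>I. (\<tau> k, \<tau>' k)) = net U m a b \<gamma> \<omega> \<tau> * cnj (net U m a b \<gamma> \<omega>' \<tau>')" for \<tau> \<tau>'
    unfolding net_fold[OF assms(1-3), symmetric] I_def by (intro net_cong assms) auto
  have loop: "(\<Prod>k\<in>I. loop_state ((\<lambda>k\<in>I. (\<tau> k, \<tau>' k)) k)) = of_bool (\<tau> = \<tau>') / ?s ^ card I"
    if "\<tau> \<in> I \<rightarrow>\<^sub>E UNIV" "\<tau>' \<in> I \<rightarrow>\<^sub>E UNIV" for \<tau> \<tau>' :: "int \<Rightarrow> 'd"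
    using prod_of_bool_eq[OF that] by (simp add: loop_state_def prod_dividef I_def)
  have fin: "finite (I \<rightarrow>\<^sub>E (UNIV :: 'd set))" by (intro finite_PiE) (auto simp: I_def)
  have "closed_net loop_state (\<lambda>x y. fold_gate (U x y)) (fold_pair m) a b \<gamma> (zip \<omega> \<omega>') =
      (\<Sum>\<tau>\<in>I \<rightarrow>\<^sub>E UNIV. \<Sum>\<tau>'\<in>I \<rightarrow>\<^sub>E UNIV. net U m a b \<gamma> \<omega> \<tau> * cnj (net U m a b \<gamma> \<omega>' \<tau>') *
         (of_bool (\<tau> = \<tau>') / ?s ^ card I))"
    unfolding closed_net_def I_def[symmetric] sum_PiE_Pair N
    by (intro sum.cong refl) (simp only: loop)
  also have "\<dots> = (\<Sum>\<tau>\<in>I \<rightarrow>\<^sub>E UNIV. \<Sum>\<tau>'\<in>I \<rightarrow>\<^sub>E UNIV. if \<tau> = \<tau>' then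
      net U m a b \<gamma> \<omega> \<tau> * cnj (net U m a b \<gamma> \<omega>' \<tau>') / ?s ^ card I else 0)"
    by (intro sum.cong refl) auto
  also have "\<dots> = (\<Sum>\<tau>\<in>I \<rightarrow>\<^sub>E UNIV. net U m a b \<gamma> \<omega> \<tau> * cnj (net U m a b \<gamma> \<omega>' \<tau>) / ?s ^ card I)"
    using fin by simp
  finally show ?thesis by (simp add: sum_divide_distrib)
qed

lemma sum_legs_zip:
  "(\<Sum>\<omega>\<in>legs_of_length n. f \<omega>) = (\<Sum>u\<in>legs_of_length n. \<Sum>v\<in>legs_of_length n. f (zip u v))"
  unfolding sum.cartesian_product
  by (rule sum.reindex_bij_witness[where i = "\<lambda>(u, v). zip u v" and j = "\<lambda>\<omega>. (map fst \<omega>, map snd \<omega>)"])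
     (auto simp: legs_of_length_def zip_map_fst_snd)

section \<open>Purity of the evolved state\<close>

text \<open>Column orthonormality of each gate on its two sites, and the identity on idle
  sites.\<close>

lemma row_isometry:
  fixes U :: "int \<Rightarrow> nat \<Rightarrow> ('q::finite) gate"
  assumes "\<And>x. even (x - int y) \<Longrightarrow> unitary (U x y)"
  shows "(\<Sum>\<sigma>\<in>{a - 1..r} \<rightarrow>\<^sub>E UNIV. row_tensor U a r y \<sigma> \<rho> * cnj (row_tensor U a r y \<sigma> \<rho>')) =
    (\<Prod>k\<in>{a - 1..r}. of_bool (\<rho> k = \<rho>' k))"
proof -
  let ?f = "\<lambda>x p q. U x y (p, q) (\<rho> (x - 1), \<rho> x) * cnj (U x y (p, q) (\<rho>' (x - 1), \<rho>' x))"
  let ?h = "\<lambda>k p. of_bool (p = \<rho> k) * of_bool (p = \<rho>' k) :: complex"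
  have "(\<Sum>\<sigma>\<in>{a - 1..r} \<rightarrow>\<^sub>E UNIV. row_tensor U a r y \<sigma> \<rho> * cnj (row_tensor U a r y \<sigma> \<rho>')) =
      (\<Sum>\<sigma>\<in>{a - 1..r} \<rightarrow>\<^sub>E UNIV. (\<Prod>x\<in>gate_positions a r y. ?f x (\<sigma> (x - 1)) (\<sigma> x)) *
         (\<Prod>k\<in>idle_sites a r y. ?h k (\<sigma> k)))"
    unfolding row_tensor_def by (simp add: prod.distrib mult_ac)
  also have "\<dots> = (\<Prod>x\<in>gate_positions a r y. of_bool (\<rho> (x - 1) = \<rho>' (x - 1)) * of_bool (\<rho> x = \<rho>' x)) *
      (\<Prod>k\<in>idle_sites a r y. of_bool (\<rho> k = \<rho>' k))"
    unfolding sum_row_factor[where f = ?f and h = ?h]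
  proof (intro arg_cong2[of _ _ _ _ "(*)"] prod.cong refl)
    fix x assume "x \<in> gate_positions a r y"
    then have "unitary (U x y)" using assms by (auto simp: gate_positions_def)
    then have "(\<Sum>r\<in>UNIV. cnj (U x y r (\<rho>' (x - 1), \<rho>' x)) * U x y r (\<rho> (x - 1), \<rho> x)) =
        of_bool ((\<rho>' (x - 1), \<rho>' x) = (\<rho> (x - 1), \<rho> x))"
      unfolding unitary_def by blast
    then show "(\<Sum>p\<in>UNIV. \<Sum>q\<in>UNIV. ?f x p q) = of_bool (\<rho> (x - 1) = \<rho>' (x - 1)) * of_bool (\<rho> x = \<rho>' x)"
      by (simp add: sum_Pair_UNIV mult.commute[of "cnj _"] eq_commute[of "\<rho>' _"] of_bool_conj)
  next
    fix k
    have "(\<Sum>p\<in>UNIV. ?h k p) = (\<Sum>p\<in>UNIV. if p = \<rho> k then of_bool (\<rho> k = \<rho>' k) else 0)"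
      by (intro sum.cong refl) auto
    then show "(\<Sum>p\<in>UNIV. ?h k p) = of_bool (\<rho> k = \<rho>' k)" by simp
  qed
  also have "\<dots> = (\<Prod>k\<in>{a - 1..r}. of_bool (\<rho> k = \<rho>' k))" by (rule prod_sites_factor[symmetric])
  finally show ?thesis .
qed

text \<open>
  The part of the evolved state to the right of the path \<open>+1, \<dots>, +1\<close>. It is an isometry from the
  open legs to the sites right of the cut, hence invisible to the purity.
\<close>

primrec right_net :: "(int \<Rightarrow> nat \<Rightarrow> ('q::finite) gate) \<Rightarrow> ('q \<Rightarrow> 'q \<Rightarrow> complex) \<Rightarrow> int \<Rightarrow> int \<Rightarrow> nat \<Rightarrow>
    'q list \<Rightarrow> (int \<Rightarrow> 'q) \<Rightarrow> complex" where
  "right_net U M b c 0 \<omega> \<sigma> = pair_tensor M (b + 2) c \<sigma>"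
| "right_net U M b c (Suc n) \<omega> \<sigma> =
     (\<Sum>\<kappa>\<in>{b - int n + 1..c} \<rightarrow>\<^sub>E UNIV.
        row_tensor U (b - int n + 1) c (Suc n) \<sigma> (\<kappa>(b - int n := hd \<omega>)) * right_net U M b c n (tl \<omega>) \<kappa>)"

lemma right_net_cong:
  assumes "\<And>k. k \<in> {b - int n + 1..c} \<Longrightarrow> \<sigma> k = \<rho> k"
  shows "right_net U M b c n \<omega> \<sigma> = right_net U M b c n \<omega> \<rho>"
proof (cases n)
  case 0
  then show ?thesis using assms pair_tensor_cong[of "b + 2" c \<sigma> \<rho>] by simp
next
  case (Suc n')
  have "row_tensor U (b - int n' + 1) c n \<sigma> \<tau> = row_tensor U (b - int n' + 1) c n \<rho> \<tau>" for \<tau>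
    using assms by (intro row_tensor_cong) (auto simp: Suc)
  then show ?thesis by (simp add: Suc)
qed

text \<open>Removing the last row by \<open>row_isometry\<close> forces its inputs to agree: the
  newest leg and the labels of the inner sum. This leaves the claim one row lower; at the bottom
  stand normalised pairs to the right of \<open>b\<close>.\<close>

lemma right_net_isometry:
  fixes U :: "int \<Rightarrow> nat \<Rightarrow> ('q::finite) gate"
  assumes U: "\<And>x y. y \<ge> 1 \<Longrightarrow> even (x - int y) \<Longrightarrow> unitary (U x y)"
    and M: "(\<Sum>p\<in>UNIV. \<Sum>q\<in>UNIV. M p q * cnj (M p q)) = 1"
    and "even b" "even c" "b + 2 \<le> c"
    and "\<omega> \<in> legs_of_length n" "\<omega>' \<in> legs_of_length n"
  shows "(\<Sum>\<sigma>\<in>{b - int n + 1..c} \<rightarrow>\<^sub>E UNIV. right_net U M b c n \<omega> \<sigma> * cnj (right_net U M b c n \<omega>' \<sigma>)) =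
    of_bool (\<omega> = \<omega>')"
  using assms(6,7)
proof (induction n arbitrary: \<omega> \<omega>')
  case 0
  have idle: "idle_sites (b + 2) c 0 = {}" using assms(3,4) by (intro idle_sites_0) auto
  have "(\<Sum>\<sigma>\<in>{b + 2 - 1..c} \<rightarrow>\<^sub>E UNIV. pair_tensor M (b + 2) c \<sigma> * cnj (pair_tensor M (b + 2) c \<sigma>)) =
     (\<Sum>\<sigma>\<in>{b + 2 - 1..c} \<rightarrow>\<^sub>E UNIV.
        (\<Prod>x\<in>gate_positions (b + 2) c 0. M (\<sigma> (x - 1)) (\<sigma> x) * cnj (M (\<sigma> (x - 1)) (\<sigma> x))) *
        (\<Prod>k\<in>idle_sites (b + 2) c 0. 1))"
    unfolding pair_tensor_def by (simp add: prod.distrib)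
  also have "\<dots> = 1"
    unfolding sum_row_factor[where f = "\<lambda>x p q. M p q * cnj (M p q)" and h = "\<lambda>k p. 1"]
    by (simp add: M idle)
  finally show ?case using 0 by (simp add: legs_of_length_def add.commute[of 1])
next
  case (Suc n)
  obtain p w p' w' where w: "\<omega> = p # w" "\<omega>' = p' # w'"
    "w \<in> legs_of_length n" "w' \<in> legs_of_length n"
    using Suc.prems by (auto simp: legs_of_length_def length_Suc_conv)
  define x where "x = b - int n"
  let ?D = "{x + 1..c} \<rightarrow>\<^sub>E (UNIV :: 'q set)"
  let ?R = "\<lambda>\<sigma> \<kappa>. row_tensor U (x + 1) c (Suc n) \<sigma> \<kappa>"
  let ?E = "right_net U M b c n"
  have finD: "finite ?D" by (intro finite_PiE) auto
  have "b - int (Suc n) + 1 = x + 1 - 1" by (simp add: x_def)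
  then have "(\<Sum>\<sigma>\<in>{b - int (Suc n) + 1..c} \<rightarrow>\<^sub>E UNIV.
        right_net U M b c (Suc n) \<omega> \<sigma> * cnj (right_net U M b c (Suc n) \<omega>' \<sigma>)) =
      (\<Sum>\<sigma>\<in>{x + 1 - 1..c} \<rightarrow>\<^sub>E UNIV. \<Sum>\<kappa>\<in>?D. \<Sum>\<kappa>'\<in>?D.
        ?E w \<kappa> * cnj (?E w' \<kappa>') * (?R \<sigma> (\<kappa>(x := p)) * cnj (?R \<sigma> (\<kappa>'(x := p')))))"
    unfolding right_net.simps x_def[symmetric] cnj_sum sum_product w list.sel complex_cnj_mult
    by (simp only: mult_ac)
  also have "\<dots> = (\<Sum>\<kappa>\<in>?D. \<Sum>\<kappa>'\<in>?D. ?E w \<kappa> * cnj (?E w' \<kappa>') *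
      (\<Sum>\<sigma>\<in>{x + 1 - 1..c} \<rightarrow>\<^sub>E UNIV. ?R \<sigma> (\<kappa>(x := p)) * cnj (?R \<sigma> (\<kappa>'(x := p')))))"
    unfolding sum_distrib_left
    by (rule trans[OF sum.swap], rule sum.cong[OF refl], rule sum.swap)
  also have "\<dots> = (\<Sum>\<kappa>\<in>?D. \<Sum>\<kappa>'\<in>?D.
      if \<kappa> = \<kappa>' then of_bool (p = p') * (?E w \<kappa> * cnj (?E w' \<kappa>')) else 0)"
  proof (intro sum.cong refl)
    fix \<kappa> \<kappa>' assume \<kappa>: "\<kappa> \<in> ?D" "\<kappa>' \<in> ?D"
    have ins: "{x + 1 - 1..c} = insert x {x + 1..c}" using assms(5) by (auto simp: x_def)
    have "(\<Sum>\<sigma>\<in>{x + 1 - 1..c} \<rightarrow>\<^sub>E UNIV. ?R \<sigma> (\<kappa>(x := p)) * cnj (?R \<sigma> (\<kappa>'(x := p')))) =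
        (\<Prod>k\<in>{x + 1 - 1..c}. of_bool ((\<kappa>(x := p)) k = (\<kappa>'(x := p')) k))"
      by (rule row_isometry) (rule U, auto)
    also have "\<dots> = of_bool (p = p') * (\<Prod>k\<in>{x + 1..c}. of_bool (\<kappa> k = \<kappa>' k))"
      unfolding ins by simp
    also have "\<dots> = of_bool (p = p') * of_bool (\<kappa> = \<kappa>')"
      by (simp only: prod_of_bool_eq[OF \<kappa> finite_atLeastAtMost_int])
    finally show "?E w \<kappa> * cnj (?E w' \<kappa>') *
        (\<Sum>\<sigma>\<in>{x + 1 - 1..c} \<rightarrow>\<^sub>E UNIV. ?R \<sigma> (\<kappa>(x := p)) * cnj (?R \<sigma> (\<kappa>'(x := p')))) =
        (if \<kappa> = \<kappa>' then of_bool (p = p') * (?E w \<kappa> * cnj (?E w' \<kappa>')) else 0)"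
      by simp
  qed
  also have "\<dots> = of_bool (p = p') * (\<Sum>\<kappa>\<in>?D. ?E w \<kappa> * cnj (?E w' \<kappa>))"
    using finD by (simp add: sum_distrib_left)
  also have "\<dots> = of_bool (\<omega> = \<omega>')"
    using Suc.IH[OF w(3,4)] by (simp add: w x_def of_bool_conj)
  finally show ?case .
qed

text \<open>With \<open>x = b - n\<close>, row \<open>n + 1\<close> is cut between the sites
  \<open>x - 1\<close> and \<open>x\<close>, where no gate is crossed. Site \<open>x\<close> belongs
  to the left part up to row \<open>n\<close> and to the right part from row \<open>n + 1\<close>
  on, so its bond in between is the leg joining the two.\<close>

lemma evolved_state_split:
  fixes U :: "int \<Rightarrow> nat \<Rightarrow> ('d::finite) gate" and m :: "'d \<Rightarrow> 'd \<Rightarrow> complex"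
  defines "M \<equiv> \<lambda>i j. m i j / of_real (sqrt (real CARD('d)))"
  assumes "even b" "a \<le> b - int n" "b \<le> c"
  shows "evolved_state U m a c n \<sigma> =
    (\<Sum>\<omega>\<in>legs_of_length n. right_net U M b c n \<omega> \<sigma> * net U M a b (replicate n 1) \<omega> \<sigma>)"
  using assms(3)
proof (induction n arbitrary: \<sigma>)
  case 0
  then show ?case
    unfolding replicate_0 sum_legs_0
    using pair_tensor_split[of b a c M] assms(2,4) by (simp add: M_def)
next
  case (Suc n)
  define x where "x = b - int n"
  let ?E = "right_net U M b c n" and ?N = "net U M a b (replicate n 1)"
  let ?L = "{a - 1..x - 1} \<rightarrow>\<^sub>E (UNIV :: 'd set)" and ?R = "{x + 1..c} \<rightarrow>\<^sub>E (UNIV :: 'd set)"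
  let ?rowL = "row_tensor U a (x - 1) (Suc n) \<sigma>" and ?rowR = "row_tensor U (x + 1) c (Suc n) \<sigma>"
  let ?cat = "\<lambda>\<tau> \<kappa> p. (\<lambda>k. if k \<in> {a - 1..x - 1} then \<tau> k else (\<kappa>(x := p)) k)"
  have ax: "a \<le> x" using Suc.prems by (simp add: x_def)
  have len: "x = b - sum_list (replicate n 1)" by (simp add: x_def sum_list_replicate)
  have split: "row_tensor U a c (Suc n) \<sigma> \<rho> = ?rowL \<rho> * ?rowR \<rho>" for \<rho>
    using row_tensor_split[of "x - 1" "Suc n" a c U \<sigma> \<rho>] assms(2,4) ax
    by (simp add: x_def add.commute)
  have union: "{a - 1..c} = {a - 1..x - 1} \<union> insert x {x + 1..c}"
    using ax assms(4) by (auto simp: x_def)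
  have cat: "row_tensor U a c (Suc n) \<sigma> (?cat \<tau> \<kappa> p) = ?rowL \<tau> * ?rowR (\<kappa>(x := p))"
    "?E \<omega> (?cat \<tau> \<kappa> p) = ?E \<omega> \<kappa>" "?N \<omega> (?cat \<tau> \<kappa> p) = ?N \<omega> (\<tau>(x := p))" for \<tau> \<kappa> p \<omega>
  proof -
    have "?rowL (?cat \<tau> \<kappa> p) = ?rowL \<tau>" by (intro row_tensor_cong) auto
    moreover have "?rowR (?cat \<tau> \<kappa> p) = ?rowR (\<kappa>(x := p))" by (intro row_tensor_cong) auto
    ultimately show "row_tensor U a c (Suc n) \<sigma> (?cat \<tau> \<kappa> p) = ?rowL \<tau> * ?rowR (\<kappa>(x := p))"
      unfolding split by simp
    show "?E \<omega> (?cat \<tau> \<kappa> p) = ?E \<omega> \<kappa>"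
      by (intro right_net_cong) (auto simp: x_def)
    show "?N \<omega> (?cat \<tau> \<kappa> p) = ?N \<omega> (\<tau>(x := p))"
      by (intro net_cong) (auto simp: len[symmetric] set_replicate_conv_if)
  qed
  have "evolved_state U m a c (Suc n) \<sigma> = (\<Sum>\<sigma>'\<in>{a - 1..c} \<rightarrow>\<^sub>E UNIV.
      row_tensor U a c (Suc n) \<sigma> \<sigma>' * (\<Sum>\<omega>\<in>legs_of_length n. ?E \<omega> \<sigma>' * ?N \<omega> \<sigma>'))"
    using Suc by simp
  also have "\<dots> = (\<Sum>\<tau>\<in>?L. \<Sum>p\<in>UNIV. \<Sum>\<kappa>\<in>?R. row_tensor U a c (Suc n) \<sigma> (?cat \<tau> \<kappa> p) *
      (\<Sum>\<omega>\<in>legs_of_length n. ?E \<omega> (?cat \<tau> \<kappa> p) * ?N \<omega> (?cat \<tau> \<kappa> p)))"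
    unfolding union by (subst sum_PiE_union, force, subst sum_PiE_insert, force, rule refl)
  also have "\<dots> = (\<Sum>\<tau>\<in>?L. \<Sum>p\<in>UNIV. \<Sum>\<kappa>\<in>?R. \<Sum>\<omega>\<in>legs_of_length n.
      (?rowR (\<kappa>(x := p)) * ?E \<omega> \<kappa>) * (?rowL \<tau> * ?N \<omega> (\<tau>(x := p))))"
    unfolding cat sum_distrib_left by (simp only: mult_ac)
  \<comment> \<open>Only the order of summation changes, until left and right factors separate into
    the two recursions.\<close>
  also have "\<dots> = (\<Sum>p\<in>UNIV. \<Sum>\<tau>\<in>?L. \<Sum>\<omega>\<in>legs_of_length n. \<Sum>\<kappa>\<in>?R.
      (?rowR (\<kappa>(x := p)) * ?E \<omega> \<kappa>) * (?rowL \<tau> * ?N \<omega> (\<tau>(x := p))))"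
    by (rule trans[OF sum.swap], rule sum.cong[OF refl], rule sum.cong[OF refl], rule sum.swap)
  also have "\<dots> = (\<Sum>p\<in>UNIV. \<Sum>\<omega>\<in>legs_of_length n. \<Sum>\<tau>\<in>?L. \<Sum>\<kappa>\<in>?R.
      (?rowR (\<kappa>(x := p)) * ?E \<omega> \<kappa>) * (?rowL \<tau> * ?N \<omega> (\<tau>(x := p))))"
    by (rule sum.cong[OF refl], rule sum.swap)
  also have "\<dots> = (\<Sum>p\<in>UNIV. \<Sum>\<omega>\<in>legs_of_length n. \<Sum>\<kappa>\<in>?R. \<Sum>\<tau>\<in>?L.
      (?rowR (\<kappa>(x := p)) * ?E \<omega> \<kappa>) * (?rowL \<tau> * ?N \<omega> (\<tau>(x := p))))"
    by (rule sum.cong[OF refl], rule sum.cong[OF refl], rule sum.swap)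
  also have "\<dots> = (\<Sum>\<omega>\<in>legs_of_length (Suc n).
      right_net U M b c (Suc n) \<omega> \<sigma> * net U M a b (replicate (Suc n) 1) \<omega> \<sigma>)"
    unfolding sum_legs_Suc replicate_Suc net_plus[OF len] right_net.simps list.sel x_def[symmetric]
      sum_product length_replicate ..
  finally show ?case .
qed

text \<open>With \<open>?E\<close> the isometry right of the cut, the density matrix is
  \<open>Q\<close> between \<open>?E\<close> and its adjoint. Hermiticity turns the trace of the
  square into a sum of squared moduli, from which the isometry drops out on either side.\<close>

lemma purity_eq:
  fixes U :: "int \<Rightarrow> nat \<Rightarrow> ('d::finite) gate" and m :: "'d \<Rightarrow> 'd \<Rightarrow> complex"
  defines "M \<equiv> \<lambda>i j. m i j / of_real (sqrt (real CARD('d)))"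
  assumes U: "\<And>x y. y \<ge> 1 \<Longrightarrow> even (x - int y) \<Longrightarrow> unitary (U x y)"
    and m: "(\<Sum>i\<in>UNIV. \<Sum>j\<in>UNIV. m i j * cnj (m i j)) = of_nat CARD('d)"
    and "even b" "a \<le> b - int n" "even c" "b + 2 \<le> c"
  shows "purity U m a c b n =
    (\<Sum>\<omega>\<in>legs_of_length n. \<Sum>\<omega>'\<in>legs_of_length n.
      (cmod (\<Sum>\<tau>\<in>{a - 1..b - int n} \<rightarrow>\<^sub>E UNIV.
         net U M a b (replicate n 1) \<omega> \<tau> * cnj (net U M a b (replicate n 1) \<omega>' \<tau>)))\<^sup>2)"
proof -
  define s where "s = b - int n + 1"
  let ?E = "right_net U M b c n" and ?N = "net U M a b (replicate n 1)"
  let ?W = "legs_of_length n :: 'd list set"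
  let ?T = "{a - 1..b - int n} \<rightarrow>\<^sub>E (UNIV :: 'd set)"
  define R where "R = {s..c} \<rightarrow>\<^sub>E (UNIV :: 'd set)"
  define Q where "Q \<omega> \<omega>' = (\<Sum>\<tau>\<in>?T. ?N \<omega> \<tau> * cnj (?N \<omega>' \<tau>))" for \<omega> \<omega>'
  define D where "D = half_line_density U m a c n s"
  have M: "(\<Sum>p\<in>UNIV. \<Sum>q\<in>UNIV. M p q * cnj (M p q)) = 1"
  proof -
    have s2: "complex_of_real (sqrt (real CARD('d))) * of_real (sqrt (real CARD('d))) = of_nat CARD('d)"
      unfolding of_real_mult[symmetric] by simp
    have "(\<Sum>p\<in>UNIV. \<Sum>q\<in>UNIV. M p q * cnj (M p q)) =
        (\<Sum>i\<in>UNIV. \<Sum>j\<in>UNIV. m i j * cnj (m i j)) / of_nat CARD('d)"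
      unfolding sum_divide_distrib by (simp add: M_def s2)
    then show ?thesis by (simp add: m)
  qed
  have iso: "(\<Sum>\<sigma>\<in>R. ?E \<omega> \<sigma> * cnj (?E \<omega>' \<sigma>)) = of_bool (\<omega> = \<omega>')" if "\<omega> \<in> ?W" "\<omega>' \<in> ?W" for \<omega> \<omega>'
    unfolding R_def s_def by (rule right_net_isometry[OF U M]) (use assms that in auto)
  have iso': "(\<Sum>\<sigma>\<in>R. cnj (?E \<omega> \<sigma>) * cnj (cnj (?E \<omega>' \<sigma>))) = of_bool (\<omega> = \<omega>')"
    if "\<omega> \<in> ?W" "\<omega>' \<in> ?W" for \<omega> \<omega>'
    using iso[OF that(2,1)] by (simp only: mult.commute[of "cnj _"] complex_cnj_cnj eq_commute[of \<omega>])
  have ev: "evolved_state U m a c n (\<lambda>k. if k < s then \<tau> k else \<rho> k) = (\<Sum>\<omega>\<in>?W. ?E \<omega> \<rho> * ?N \<omega> \<tau>)" for \<tau> \<rho>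
  proof -
    have "?E \<omega> (\<lambda>k. if k < s then \<tau> k else \<rho> k) = ?E \<omega> \<rho>" for \<omega>
      by (intro right_net_cong) (auto simp: s_def)
    moreover have "?N \<omega> (\<lambda>k. if k < s then \<tau> k else \<rho> k) = ?N \<omega> \<tau>" for \<omega>
      by (intro net_cong) (auto simp: s_def sum_list_replicate set_replicate_conv_if)
    ultimately show ?thesis
      using evolved_state_split[of b a n c U m] assms by (simp add: M_def)
  qed
  have sites: "{a - 1..<s} = {a - 1..b - int n}" by (auto simp: s_def)
  have D: "D \<sigma> \<sigma>' = (\<Sum>\<omega>\<in>?W. ?E \<omega> \<sigma> * (\<Sum>\<omega>'\<in>?W. cnj (?E \<omega>' \<sigma>') * Q \<omega> \<omega>'))" for \<sigma> \<sigma>'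
  proof -
    have "D \<sigma> \<sigma>' = (\<Sum>\<tau>\<in>?T. \<Sum>\<omega>\<in>?W. \<Sum>\<omega>'\<in>?W. ?E \<omega> \<sigma> * (cnj (?E \<omega>' \<sigma>') * (?N \<omega> \<tau> * cnj (?N \<omega>' \<tau>))))"
      unfolding D_def half_line_density_def ev sites cnj_sum sum_product complex_cnj_mult
      by (simp only: mult_ac)
    also have "\<dots> = (\<Sum>\<omega>\<in>?W. \<Sum>\<omega>'\<in>?W. \<Sum>\<tau>\<in>?T. ?E \<omega> \<sigma> * (cnj (?E \<omega>' \<sigma>') * (?N \<omega> \<tau> * cnj (?N \<omega>' \<tau>))))"
      by (rule trans[OF sum.swap], rule sum.cong[OF refl], rule sum.swap)
    finally show ?thesis by (simp only: sum_distrib_left Q_def)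
  qed
  have herm: "cnj (D \<sigma> \<sigma>') = D \<sigma>' \<sigma>" for \<sigma> \<sigma>'
    unfolding D_def half_line_density_def cnj_sum by (simp add: mult.commute)
  have "purity U m a c b n = Re (\<Sum>\<sigma>\<in>R. \<Sum>\<sigma>'\<in>R. D \<sigma> \<sigma>' * D \<sigma>' \<sigma>)"
    unfolding purity_def Let_def s_def[symmetric] R_def[symmetric] D_def[symmetric] ..
  also have "(\<Sum>\<sigma>\<in>R. \<Sum>\<sigma>'\<in>R. D \<sigma> \<sigma>' * D \<sigma>' \<sigma>) = of_real (\<Sum>\<sigma>\<in>R. \<Sum>\<sigma>'\<in>R. (cmod (D \<sigma> \<sigma>'))\<^sup>2)"
    unfolding of_real_sum complex_norm_square by (intro sum.cong refl) (simp only: herm)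
  also have "(\<Sum>\<sigma>\<in>R. \<Sum>\<sigma>'\<in>R. (cmod (D \<sigma> \<sigma>'))\<^sup>2) = (\<Sum>\<sigma>'\<in>R. \<Sum>\<sigma>\<in>R. (cmod (D \<sigma> \<sigma>'))\<^sup>2)"
    by (rule sum.swap)
  \<comment> \<open>Summing the row index at fixed column index strips one isometry; the column
    index then strips the other.\<close>
  also have "\<dots> = (\<Sum>\<sigma>'\<in>R. \<Sum>\<omega>\<in>?W. (cmod (\<Sum>\<omega>'\<in>?W. cnj (?E \<omega>' \<sigma>') * Q \<omega> \<omega>'))\<^sup>2)"
    unfolding D by (intro sum.cong refl sum_norm_isometry iso) simp_all
  also have "\<dots> = (\<Sum>\<omega>\<in>?W. \<Sum>\<sigma>'\<in>R. (cmod (\<Sum>\<omega>'\<in>?W. cnj (?E \<omega>' \<sigma>') * Q \<omega> \<omega>'))\<^sup>2)"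
    by (rule sum.swap)
  also have "\<dots> = (\<Sum>\<omega>\<in>?W. \<Sum>\<omega>'\<in>?W. (cmod (Q \<omega> \<omega>'))\<^sup>2)"
    by (intro sum.cong refl sum_norm_isometry iso') simp_all
  finally show ?thesis unfolding Q_def by simp
qed

lemma card_gate_positions_0:
  assumes "even a" "even r" "a \<le> r"
  shows "2 * card (gate_positions a r 0) = card {a - 1..r}"
proof -
  obtain a' r' where ar: "a = 2 * a'" "r = 2 * r'" using assms by (auto elim!: evenE)
  have "gate_positions a r 0 = (\<lambda>k. 2 * k) ` {a'..r'}"
  proof (intro equalityI subsetI)
    fix x assume "x \<in> gate_positions a r 0"
    then have x: "even x" "2 * a' \<le> x" "x \<le> 2 * r'" by (simp_all add: gate_positions_def ar)
    then obtain k where "x = 2 * k" by blast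
    then show "x \<in> (\<lambda>k. 2 * k) ` {a'..r'}" using x by auto
  qed (auto simp: gate_positions_def ar)
  then have "card (gate_positions a r 0) = card {a'..r'}"
    by (simp add: card_image inj_on_def)
  then show ?thesis using assms(3) by (simp add: ar)
qed

section \<open>Folded dual-unitary circuits\<close>

lemma sum_shuffle:
  "(\<Sum>r\<in>(UNIV :: (('a::finite \<times> 'a) \<times> ('a \<times> 'a)) set). f r) =
   (\<Sum>u\<in>UNIV. \<Sum>v\<in>UNIV. f ((fst u, fst v), (snd u, snd v)))"
  unfolding sum.cartesian_product
  by (rule sum.reindex_bij_witness
        [where i = "\<lambda>(u, v). ((fst u, fst v), (snd u, snd v))"
           and j = "\<lambda>((k, k'), (l, l')). ((k, l), (k', l'))"]) auto

lemma fold_gate_shuffle: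
  "fold_gate V p q = V (fst (fst p), fst (snd p)) (fst (fst q), fst (snd q)) *
     cnj (V (snd (fst p), snd (snd p)) (snd (fst q), snd (snd q)))"
  by (simp add: fold_gate_def case_prod_beta)

text \<open>Regrouped by copies instead of legs, the folded gate is the tensor product of
  \<open>V\<close> with its conjugate, and the sums over the two copies decouple.\<close>

lemma unitary_fold_gate:
  assumes "unitary V"
  shows "unitary (fold_gate V)"
proof -
  have r: "(\<Sum>r\<in>UNIV. V p r * cnj (V q r)) = of_bool (p = q)"
    and c: "(\<Sum>r\<in>UNIV. cnj (V r p) * V r q) = of_bool (p = q)" for p q
    using assms unfolding unitary_def by blast+
  have prod_eq: "of_bool ((fst (fst p), fst (snd p)) = (fst (fst q), fst (snd q))) *
      of_bool ((snd (fst p), snd (snd p)) = (snd (fst q), snd (snd q))) = (of_bool (p = q) :: complex)"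
    for p q :: "('a \<times> 'a) \<times> ('a \<times> 'a)"
    by (auto simp: prod_eq_iff)
  have "(\<Sum>r\<in>UNIV. fold_gate V p r * cnj (fold_gate V q r)) = of_bool (p = q)" for p q
  proof -
    let ?p = "(fst (fst p), fst (snd p))" and ?p' = "(snd (fst p), snd (snd p))"
    let ?q = "(fst (fst q), fst (snd q))" and ?q' = "(snd (fst q), snd (snd q))"
    have "(\<Sum>r\<in>UNIV. fold_gate V p r * cnj (fold_gate V q r)) =
        (\<Sum>u\<in>UNIV. V ?p u * cnj (V ?q u)) * cnj (\<Sum>v\<in>UNIV. V ?p' v * cnj (V ?q' v))"
      unfolding sum_shuffle fold_gate_shuffle cnj_sum sum_product by (simp add: mult_ac)
    then show ?thesis by (simp only: r cnj_of_bool prod_eq)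
  qed
  moreover have "(\<Sum>r\<in>UNIV. cnj (fold_gate V r p) * fold_gate V r q) = of_bool (p = q)" for p q
  proof -
    let ?p = "(fst (fst p), fst (snd p))" and ?p' = "(snd (fst p), snd (snd p))"
    let ?q = "(fst (fst q), fst (snd q))" and ?q' = "(snd (fst q), snd (snd q))"
    have "(\<Sum>r\<in>UNIV. cnj (fold_gate V r p) * fold_gate V r q) =
        (\<Sum>u\<in>UNIV. cnj (V u ?p) * V u ?q) * cnj (\<Sum>v\<in>UNIV. cnj (V v ?p') * V v ?q')"
      unfolding sum_shuffle fold_gate_shuffle cnj_sum sum_product by (simp add: mult_ac)
    then show ?thesis by (simp only: c cnj_of_bool prod_eq)
  qed
  ultimately show ?thesis unfolding unitary_def by blast
qed

lemma dual_gate_fold: "dual_gate (fold_gate U) = fold_gate (dual_gate U)"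
  by (auto simp: fun_eq_iff dual_gate_def fold_gate_def)

lemma loop_state_mult:
  "loop_state (fst u, fst v) * loop_state (snd u, snd v) =
    (of_bool (u = v) / of_nat CARD('d) :: complex)" for u v :: "'d::finite \<times> 'd"
proof -
  have s2: "complex_of_real (sqrt (real CARD('d))) * of_real (sqrt (real CARD('d))) = of_nat CARD('d)"
    unfolding of_real_mult[symmetric] by simp
  show ?thesis by (auto simp: loop_state_def s2 prod_eq_iff)
qed

text \<open>Two loops together identify the pairs of labels of the two copies with weight 1 / d, so
  closing becomes a single sum over the common pair.\<close>

lemma sum_loop_state_mult:
  fixes F :: "('d::finite \<times> 'd) \<Rightarrow> ('d \<times> 'd) \<Rightarrow> complex"
  shows "(\<Sum>k\<in>UNIV. \<Sum>l\<in>UNIV. F k l * (loop_state k * loop_state l)) =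
    (\<Sum>u\<in>UNIV. F (fst u, fst u) (snd u, snd u)) / of_nat CARD('d)"
proof -
  have "(\<Sum>k\<in>UNIV. \<Sum>l\<in>UNIV. F k l * (loop_state k * loop_state l)) =
      (\<Sum>r\<in>UNIV. F (fst r) (snd r) * (loop_state (fst r) * loop_state (snd r)))"
    by (simp add: sum_Pair_UNIV[of "\<lambda>r. F (fst r) (snd r) * (loop_state (fst r) * loop_state (snd r))"])
  also have "\<dots> = (\<Sum>u\<in>UNIV. \<Sum>v\<in>UNIV. F (fst u, fst v) (snd u, snd v) *
      (of_bool (u = v) / of_nat CARD('d)))"
    unfolding sum_shuffle by (simp only: fst_conv snd_conv loop_state_mult)
  also have "\<dots> = (\<Sum>u\<in>UNIV. \<Sum>v\<in>UNIV. if u = v then F (fst u, fst v) (snd u, snd v) / of_nat CARD('d) else 0)"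
    by (intro sum.cong refl) auto
  finally show ?thesis by (simp add: sum_divide_distrib)
qed

text \<open>Closing a folded gate is the unitarity relation between the copies, closing a folded
  pair is the normalisation of \<open>m\<close>, and folding commutes with taking the dual
  gate.\<close>

lemma solvable_network_fold:
  fixes U :: "int \<Rightarrow> nat \<Rightarrow> ('d::finite) gate" and m :: "'d \<Rightarrow> 'd \<Rightarrow> complex"
  assumes U: "\<And>x y. y \<ge> 1 \<Longrightarrow> even (x - int y) \<Longrightarrow> dual_unitary (U x y)"
    and m: "(\<Sum>i\<in>UNIV. \<Sum>j\<in>UNIV. m i j * cnj (m i j)) = of_nat CARD('d)"
    and "even a" "even b"
  shows "solvable_network (\<lambda>x y. fold_gate (U x y)) (fold_pair m) loop_state a b"
proof
  fix x :: int and y :: nat and i j :: "'d \<times> 'd"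
  assume xy: "y \<ge> 1" "even (x - int y)"
  let ?p = "(fst i, fst j)" and ?p' = "(snd i, snd j)"
  have "(\<Sum>k\<in>UNIV. \<Sum>l\<in>UNIV. fold_gate (U x y) (k, l) (i, j) * (loop_state k * loop_state l)) =
      (\<Sum>u\<in>UNIV. cnj (U x y u ?p') * U x y u ?p) / of_nat CARD('d)"
    unfolding sum_loop_state_mult[where F = "\<lambda>k l. fold_gate (U x y) (k, l) (i, j)"]
    by (simp add: fold_gate_shuffle mult.commute)
  also have "\<dots> = of_bool (?p' = ?p) / of_nat CARD('d)"
    using U[OF xy] unfolding dual_unitary_def unitary_def by simp
  also have "\<dots> = loop_state i * loop_state j"
    using loop_state_mult[of ?p ?p'] by (simp add: eq_commute[of "snd _"])
  finally show "(\<Sum>k\<in>UNIV. \<Sum>l\<in>UNIV. fold_gate (U x y) (k, l) (i, j) * (loop_state k * loop_state l)) =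
      loop_state i * loop_state j" .
  show "unitary (dual_gate (fold_gate (U x y)))"
    unfolding dual_gate_fold using U[OF xy] unfolding dual_unitary_def by (intro unitary_fold_gate) simp
next
  have "(\<Sum>k\<in>UNIV. \<Sum>l\<in>UNIV. fold_pair m k l * (loop_state k * loop_state l)) =
      (\<Sum>u\<in>UNIV. m (fst u) (snd u) * cnj (m (fst u) (snd u))) / of_nat CARD('d)"
    unfolding sum_loop_state_mult by (simp add: fold_pair_def)
  also have "(\<Sum>u\<in>UNIV. m (fst u) (snd u) * cnj (m (fst u) (snd u))) = of_nat CARD('d)"
    unfolding sum_Pair_UNIV using m by simp
  finally show "(\<Sum>k\<in>UNIV. \<Sum>l\<in>UNIV. fold_pair m k l * (loop_state k * loop_state l)) = 1" by simp
next
  have "(\<Sum>p\<in>UNIV. (cmod ((loop_state :: 'd \<times> 'd \<Rightarrow> complex) p))\<^sup>2) =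
      (\<Sum>i\<in>(UNIV :: 'd set). \<Sum>j\<in>UNIV. if i = j then 1 / real CARD('d) else 0)"
    unfolding sum_Pair_UNIV
    by (intro sum.cong refl) (simp add: loop_state_def norm_divide power_divide)
  also have "\<dots> = 1" by simp
  finally show "(\<Sum>p\<in>UNIV. (cmod ((loop_state :: 'd \<times> 'd \<Rightarrow> complex) p))\<^sup>2) = 1" .
qed (auto simp: loop_state_def assms)

text \<open>With \<open>s\<close> the square root of d, the pairs contribute s^(2 P) and the loops
  s^(- card I). Each pair covers two sites, so 2 P = n + card I, which leaves s^n in the amplitude
  and d^n in the norm.\<close>

lemma norm_closed_net_replicate:
  fixes U :: "int \<Rightarrow> nat \<Rightarrow> ('d::finite) gate" and m :: "'d \<Rightarrow> 'd \<Rightarrow> complex"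
  assumes U: "\<And>x y. y \<ge> 1 \<Longrightarrow> even (x - int y) \<Longrightarrow> unitary (U x y)"
    and m: "(\<Sum>i\<in>UNIV. \<Sum>j\<in>UNIV. m i j * cnj (m i j)) = of_nat CARD('d)"
    and ab: "even a" "even b" "a \<le> b - int n" and c: "even c" "b + 2 \<le> c"
  shows "(\<Sum>\<omega>\<in>legs_of_length n. (cmod (closed_net loop_state (\<lambda>x y. fold_gate (U x y)) (fold_pair m)
      a b (replicate n 1) \<omega>))\<^sup>2) = real CARD('d) ^ n * purity U m a c b n"
proof -
  define s where "s = complex_of_real (sqrt (real CARD('d)))"
  define M where "M = (\<lambda>i j. m i j / s)"
  define P where "P = card (gate_positions a b 0)"
  define I where "I = {a - 1..b - int n}"
  define Q where "Q u v = (\<Sum>\<tau>\<in>I \<rightarrow>\<^sub>E UNIV.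
      net U M a b (replicate n 1) u \<tau> * cnj (net U M a b (replicate n 1) v \<tau>))" for u v
  have s: "s \<noteq> 0" "cnj s = s" "cmod s ^ 2 = real CARD('d)" by (simp_all add: s_def)
  have "2 * P = card {a - 1..b}" unfolding P_def using ab by (intro card_gate_positions_0) auto
  then have PI: "2 * P = n + card I" using ab by (simp add: I_def)
  have nm: "net U m a b \<gamma> \<omega> \<tau> = s ^ P * net U M a b \<gamma> \<omega> \<tau>" for \<gamma> \<omega> \<tau>
    unfolding M_def net_scale P_def[symmetric] using s by simp
  have "(cmod (closed_net loop_state (\<lambda>x y. fold_gate (U x y)) (fold_pair m) a b (replicate n 1) (zip u v)))\<^sup>2
      = real CARD('d) ^ n * (cmod (Q u v))\<^sup>2"
    if "u \<in> legs_of_length n" "v \<in> legs_of_length n" for u v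
  proof -
    have len: "length u = length (replicate n (1 :: int))" "length v = length (replicate n (1 :: int))"
      using that by (auto simp: legs_of_length_def)
    have set1: "set (replicate n (1 :: int)) \<subseteq> {1, - 1}" by (auto simp: set_replicate_conv_if)
    have I: "{a - 1..b - sum_list (replicate n 1)} = I" by (simp add: I_def sum_list_replicate)
    have "closed_net loop_state (\<lambda>x y. fold_gate (U x y)) (fold_pair m) a b (replicate n 1) (zip u v) =
        s ^ (2 * P) * Q u v / s ^ card I"
      unfolding closed_net_fold[OF set1 len] I s_def[symmetric] nm Q_def sum_distrib_left
      by (simp add: s power_mult_distrib power2_eq_square power_mult mult_ac)
    also have "\<dots> = s ^ n * Q u v" using s by (simp add: PI power_add)
    finally have "(cmod (closed_net loop_state (\<lambda>x y. fold_gate (U x y)) (fold_pair m) a b (replicate n 1)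
        (zip u v)))\<^sup>2 = (cmod s ^ 2) ^ n * (cmod (Q u v))\<^sup>2"
      by (simp add: norm_mult norm_power power_mult_distrib power_mult[symmetric] mult.commute)
    then show ?thesis by (simp only: s)
  qed
  then have "(\<Sum>\<omega>\<in>legs_of_length n. (cmod (closed_net loop_state (\<lambda>x y. fold_gate (U x y)) (fold_pair m)
      a b (replicate n 1) \<omega>))\<^sup>2) =
      (\<Sum>u\<in>legs_of_length n. \<Sum>v\<in>legs_of_length n. real CARD('d) ^ n * (cmod (Q u v))\<^sup>2)"
    unfolding sum_legs_zip by (intro sum.cong refl) simp
  also have "(\<Sum>u\<in>legs_of_length n. \<Sum>v\<in>legs_of_length n. real CARD('d) ^ n * (cmod (Q u v))\<^sup>2) =
      real CARD('d) ^ n * (\<Sum>u\<in>legs_of_length n. \<Sum>v\<in>legs_of_length n. (cmod (Q u v))\<^sup>2)"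
    by (simp only: sum_distrib_left)
  also have "(\<Sum>u\<in>legs_of_length n. \<Sum>v\<in>legs_of_length n. (cmod (Q u v))\<^sup>2) = purity U m a c b n"
    unfolding Q_def M_def s_def I_def by (rule purity_eq[symmetric]) (use assms in auto)
  finally show ?thesis .
qed

section \<open>Positivity and assembly of the bound\<close>

context solvable_network
begin

text \<open>Closing all legs with loops gives 1, so the vector cannot vanish.\<close>

lemma norm2_pos:
  assumes "set \<gamma> \<subseteq> {1, - 1}" and "a \<le> b - int (length \<gamma>)"
  shows "0 < norm2 \<gamma>"
proof (rule ccontr)
  assume "\<not> 0 < norm2 \<gamma>"
  then have "norm2 \<gamma> = 0" unfolding norm2_def using sum_nonneg[of "legs_of_length (length \<gamma>)" "\<lambda>\<omega>. (cmod (L \<gamma> \<omega>))\<^sup>2"] by force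
  then have "L \<gamma> r = 0" if "r \<in> legs_of_length (length \<gamma>)" for r
    using that by (simp add: norm2_def sum_nonneg_eq_0_iff)
  then show False using close_top_legs[of \<gamma> "[]" "[]"] assms by (simp add: closed_net_Nil)
qed

lemma norm_loops: "(\<Sum>r\<in>legs_of_length n. (cmod (\<Prod>p\<leftarrow>r. \<eta> p))\<^sup>2) = 1"
proof (induction n)
  case (Suc n)
  have "(\<Sum>r\<in>legs_of_length (Suc n). (cmod (\<Prod>p\<leftarrow>r. \<eta> p))\<^sup>2) =
      (\<Sum>p\<in>UNIV. (cmod (\<eta> p))\<^sup>2) * (\<Sum>r\<in>legs_of_length n. (cmod (\<Prod>p\<leftarrow>r. \<eta> p))\<^sup>2)"
    unfolding sum_legs_Suc sum_product by (simp add: norm_mult power_mult_distrib)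
  then show ?case by (simp add: Suc loop_norm)
qed (simp add: sum_legs_0)

end

theorem mainTheorem1:
  fixes U :: "int \<Rightarrow> nat \<Rightarrow> ('d::finite) gate"
    and m :: "'d \<Rightarrow> 'd \<Rightarrow> complex"
    and \<gamma> :: "int list"
    and a b c :: int
    and l \<tau>A \<tau>B \<tau> :: nat
    and \<alpha> :: real
  assumes "CARD('d) \<ge> 2"
    and "\<And>x y. y \<ge> 1 \<Longrightarrow> even (x - int y) \<Longrightarrow> dual_unitary (U x y)"
    and "(\<Sum>i\<in>UNIV. \<Sum>j\<in>UNIV. m i j * cnj (m i j)) = of_nat CARD('d)"
    and "set \<gamma> \<subseteq> {1, -1}"
    and "even b"
    (* The network and the chain on which the purities are computed, with sites {a - 1..c}, extend
       beyond all the backward light cones involved, hence are sufficiently large. *)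
    and "even a" and "a \<le> b - 2 * int (length \<gamma>)"
    and "even c" and "c \<ge> b + 2"
    and "l \<le> length \<gamma>"
    and "\<tau>A = count_list (take l \<gamma>) 1"
    and "\<tau>B = count_list (drop l \<gamma>) 1"
    and "\<tau> = \<tau>A + \<tau>B"
    and "\<alpha> > 1"
  shows "renyi_entropy \<alpha> (reduced_density l (length \<gamma>) (influence_matrix U m a b \<gamma>))
           \<le> \<alpha> / (\<alpha> - 1) *
             ln (real CARD('d) ^ \<tau>A * purity U m a c b \<tau> / purity U m a c b \<tau>B)"
proof -
  interpret solvable_network "\<lambda>x y. fold_gate (U x y)" "fold_pair m" loop_state a b
    using assms by (intro solvable_network_fold) auto
  let ?d = "real CARD('d)"
  have un: "\<And>x y. y \<ge> 1 \<Longrightarrow> even (x - int y) \<Longrightarrow> unitary (U x y)"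
    using assms(2) by (simp add: dual_unitary_def)
  \<comment> \<open>Dropping top steps keeps the bottom end \<open>b\<close>, so one formula with
    the same \<open>a\<close> and \<open>c\<close> serves the whole path and its lower part.\<close>
  have norm2_purity: "norm2 \<gamma>' = ?d ^ count_list \<gamma>' 1 * purity U m a c b (count_list \<gamma>' 1)"
    if "set \<gamma>' \<subseteq> {1, - 1}" "length \<gamma>' \<le> length \<gamma>" for \<gamma>'
  proof -
    have "a \<le> b - int (count_list \<gamma>' 1)" "a \<le> b - int (length \<gamma>')"
      using count_le_length[of \<gamma>' 1] assms(7) that(2) by linarith+
    then show ?thesis
      using norm2_eq_replicate[OF that(1)] norm_closed_net_replicate[OF un assms(3,6,5) _ assms(8,9)]
      by (simp add: norm2_def)
  qed
  have lenA: "length (take l \<gamma>) = l" and lenB: "length (drop l \<gamma>) = length \<gamma> - l"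
    using assms(10) by auto
  have setB: "set (drop l \<gamma>) \<subseteq> {1, - 1}" using assms(4) set_drop_subset[of l \<gamma>] by auto
  have count: "count_list \<gamma> 1 = \<tau>"
    using count_list_append[of "take l \<gamma>" "drop l \<gamma>" 1] assms(11-13) by simp
  have IM: "influence_matrix U m a b \<gamma> \<omega> = L \<gamma> \<omega>" if "length \<omega> = length \<gamma>" for \<omega>
    using that assms(4,7) by (intro influence_matrix_eq_closed_net) auto
  have overlap: "(\<Sum>r\<in>legs_of_length l. cnj (\<Prod>p\<leftarrow>r. loop_state p) * influence_matrix U m a b \<gamma> (r @ s))
      = L (drop l \<gamma>) s" if "s \<in> legs_of_length (length \<gamma> - l)" for s
  proof -
    have "(\<Sum>r\<in>legs_of_length l. cnj (\<Prod>p\<leftarrow>r. loop_state p) * influence_matrix U m a b \<gamma> (r @ s)) =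
        (\<Sum>r\<in>legs_of_length (length (take l \<gamma>)). cnj (\<Prod>p\<leftarrow>r. loop_state p) *
          L (take l \<gamma> @ drop l \<gamma>) (r @ s))"
      unfolding lenA append_take_drop_id
      using that assms(10) by (intro sum.cong refl) (simp add: IM legs_of_length_def)
    also have "\<dots> = L (drop l \<gamma>) s"
      using assms(4,7) by (intro close_top_legs) simp_all
    finally show ?thesis .
  qed
  have pos: "0 < norm2 \<gamma>" "0 < norm2 (drop l \<gamma>)"
    using assms(4,7) setB by (auto intro!: norm2_pos)
  have "renyi_entropy \<alpha> (reduced_density l (length \<gamma>) (influence_matrix U m a b \<gamma>))
      \<le> \<alpha> / (\<alpha> - 1) * ln (norm2 \<gamma> / norm2 (drop l \<gamma>))"
  proof (rule renyi_entropy_reduced_density_le[OF assms(14)])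
    show "(\<Sum>\<omega>\<in>legs_of_length (length \<gamma>). (cmod (influence_matrix U m a b \<gamma> \<omega>))\<^sup>2) = norm2 \<gamma>"
      unfolding norm2_def by (intro sum.cong refl) (simp add: IM legs_of_length_def)
    show "(\<Sum>r\<in>legs_of_length l. (cmod (\<Prod>p\<leftarrow>r. (loop_state :: 'd \<times> 'd \<Rightarrow> complex) p))\<^sup>2) = 1" by (rule norm_loops)
    show "(\<Sum>s\<in>legs_of_length (length \<gamma> - l).
        (cmod (\<Sum>r\<in>legs_of_length l. cnj (\<Prod>p\<leftarrow>r. loop_state p) * influence_matrix U m a b \<gamma> (r @ s)))\<^sup>2) =
        norm2 (drop l \<gamma>)"
      unfolding norm2_def lenB by (intro sum.cong refl) (simp only: overlap)
  qed (rule pos)+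
  \<comment> \<open>The exponents \<tau> and \<tau>B of d differ by \<tau>A.\<close>
  also have "norm2 \<gamma> / norm2 (drop l \<gamma>) = ?d ^ \<tau>A * purity U m a c b \<tau> / purity U m a c b \<tau>B"
    using norm2_purity[OF assms(4)] norm2_purity[OF setB] assms(12,13) count
    by (simp add: power_add)
  finally show ?thesis .
qed

end
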